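(* Let $R$ be a ring, let ${}_l\mathfrak{F}_r^1\subseteq{}_l\mathfrak{F}_r^2$ be symmetric Gabriel filters for $R$ with ${}_l\mathfrak{F}_r^1$ differential, and let $M$ be an $R$-bimodule. If either (i) ${}_lM_r^1$ is torsion-free with respect to the torsion theory corresponding to ${}_l\mathfrak{F}_r^2$, or (ii) ${}_l\mathfrak{F}_r^2$ is differential, then any derivation on $M$ (that is, any $\delta$-derivation on $M$, for any derivation $\delta$ on $R$) extends both to ${}_lM_r^1$ and to ${}_lM_r^2$ in such a way that the extensions on ${}_lM_r^1$ and ${}_lM_r^2$ agree. For $M=R$, any one of (i), (ii), or (iii) ${}_l\mathfrak{F}_r^1$ and ${}_l\mathfrak{F}_r^2$ are faithful, implies that any derivation on $R$ extends both to ${}_lR_r^1$ and to ${}_lR_r^2$ in such a way that the extensions on ${}_lR_r^1$ and ${}_lR_r^2$ agree.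
   Context: Rings are associative with identity and modules are unital. Derivations. A derivation on a ring $R$ is an additive map $\delta:R\to R$ with $\delta(rs)=\delta(r)s+r\delta(s)$. For an $R$-bimodule $M$, a $\delta$-derivation on $M$ is an additive map $d:M\to M$ with $d(xr)=d(x)r+x\delta(r)$ and $d(rx)=\delta(r)x+rd(x)$ for all $x\in M$, $r\in R$. Symmetric filters. An $R$-bimodule $M$ is a right $R\otimes_{\mathbb{Z}}R^{op}$-module via $x(r\otimes s)=sxr$. If $\mathfrak{F}_l$ is a Gabriel filter of left ideals and $\mathfrak{F}_r$ a Gabriel filter of right ideals of $R$, the symmetric filter ${}_l\mathfrak{F}_r$ induced by them is the set of right ideals of $R\otimes_{\mathbb{Z}}R^{op}$ containing one of the form $J\otimes R^{op}+R\otimes I$ (the sum of the images in $R\otimes_{\mathbb{Z}}R^{op}$) with $I\in\mathfrak{F}_l$, $J\in\mathfrak{F}_r$. It is a Gabriel filter, with torsion submodule ${}_l\mathcal{T}_r(M)=\{x\in M:\{t\in R\otimes_{\mathbb{Z}}R^{op}:xt=0\}\in{}_l\mathfrak{F}_r\}$. It is faithful if ${}_l\mathcal{T}_r(R)=0$ for the bimodule $R$. It is differential if for every $I\in{}_l\mathfrak{F}_r$ there is $J\in{}_l\mathfrak{F}_r$ such that $\overline{\delta}(J)\subseteq I$ for all derivations $\overline{\delta}$ of the ring $R\otimes_{\mathbb{Z}}R^{op}$ (every derivation $\delta$ on $R$ determines such a derivation by $\overline{\delta}(r\otimes s)=\delta(r)\otimes s+r\otimes\delta(s)$). Here ${}_l\mathfrak{F}_r^i$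 ($i=1,2$) is the symmetric filter induced by Gabriel filters $\mathfrak{F}_l^i$ and $\mathfrak{F}_r^i$, and ${}_l\mathcal{T}_r^i$ is its torsion submodule. Symmetric modules of quotients. ${}_lM_r^i=\varinjlim_{K\in{}_l\mathfrak{F}_r^i}\mathrm{Hom}(K,M/{}_l\mathcal{T}_r^i(M))$ (homomorphisms of right $R\otimes_{\mathbb{Z}}R^{op}$-modules). The map $q_i:M\to{}_lM_r^i$ sends $m$ to the class of $t\mapsto(m+{}_l\mathcal{T}_r^i(M))t$. The map $q_{12}:{}_lM_r^1\to{}_lM_r^2$ sends the class of $f:K\to M/{}_l\mathcal{T}_r^1(M)$ to the class of its composite with the projection $M/{}_l\mathcal{T}_r^1(M)\to M/{}_l\mathcal{T}_r^2(M)$; then $q_{12}q_1=q_2$. Extensions and agreement. A $\delta$-derivation $d$ on $M$ extends to ${}_lM_r^i$ if there is a $\delta$-derivation $d_i$ on the bimodule ${}_lM_r^i$ with $d_iq_i=q_id$. The extensions of $d$ on ${}_lM_r^1$ and ${}_lM_r^2$ agree if $d$ extends to $\delta$-derivations $d_1,d_2$ with $d_1q_1=q_1d$, $d_2q_2=q_2d$ and $d_2q_{12}=q_{12}d_1$. For $M=R$ take $d=\delta$. *)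

theory Defs
  imports "HOL-Algebra.Free_Abelian_Groups" "HOL-Algebra.Generated_Groups"
    "HOL-Algebra.QuotRing" "HOL-Algebra.Module"
begin

section \<open>Opposite rings and tensor products of rings over the integers\<close>

definition op_ring :: "('a, 'x) ring_scheme \<Rightarrow> ('a, 'x) ring_scheme"
  where "op_ring R = R\<lparr>mult := (\<lambda>x y. y \<otimes>\<^bsub>R\<^esub> x)\<rparr>"

text \<open>
  The tensor product is the quotient of the free abelian group on
  \<open>carrier R \<times> carrier S\<close>, with the multiplication
  \<open>(r, s) (r', s') = (r r', s s')\<close> extended bilinearly, by the subgroup generated by the
  biadditivity relations. Over the integers these imply the balancing relations.
\<close>

definition pair_ring :: "('a, 'x) ring_scheme \<Rightarrow> ('b, 'y) ring_scheme \<Rightarrow> ('a \<times> 'b \<Rightarrow>\<^sub>0 int) ring"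
  where "pair_ring R S =
    \<lparr>carrier = carrier (free_Abelian_group (carrier R \<times> carrier S)),
     mult = (\<lambda>x y. frag_extend (\<lambda>(r, s). frag_extend (\<lambda>(r', s').
        frag_of (r \<otimes>\<^bsub>R\<^esub> r', s \<otimes>\<^bsub>S\<^esub> s')) y) x),
     one = frag_of (\<one>\<^bsub>R\<^esub>, \<one>\<^bsub>S\<^esub>),
     zero = 0,
     add = (+)\<rparr>"

definition tensor_relations ::
    "('a, 'x) ring_scheme \<Rightarrow> ('b, 'y) ring_scheme \<Rightarrow> ('a \<times> 'b \<Rightarrow>\<^sub>0 int) set"
  where "tensor_relations R S =
    {frag_of (r \<oplus>\<^bsub>R\<^esub> r', s) - frag_of (r, s) - frag_of (r', s) | r r' s.
        r \<in> carrier R \<and> r' \<in> carrier R \<and> s \<in> carrier S} \<union>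
    {frag_of (r, s \<oplus>\<^bsub>S\<^esub> s') - frag_of (r, s) - frag_of (r, s') | r s s'.
        r \<in> carrier R \<and> s \<in> carrier S \<and> s' \<in> carrier S}"

definition tensor_kernel ::
    "('a, 'x) ring_scheme \<Rightarrow> ('b, 'y) ring_scheme \<Rightarrow> ('a \<times> 'b \<Rightarrow>\<^sub>0 int) set"
  where "tensor_kernel R S =
    generate (free_Abelian_group (carrier R \<times> carrier S)) (tensor_relations R S)"

definition tensor_ring ::
    "('a, 'x) ring_scheme \<Rightarrow> ('b, 'y) ring_scheme \<Rightarrow> ('a \<times> 'b \<Rightarrow>\<^sub>0 int) set ring"
  where "tensor_ring R S = pair_ring R S Quot tensor_kernel R S"

definition pure_tensor ::
    "('a, 'x) ring_scheme \<Rightarrow> ('b, 'y) ring_scheme \<Rightarrow> 'a \<Rightarrow> 'b \<Rightarrow> ('a \<times> 'b \<Rightarrow>\<^sub>0 int) set"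
  where "pure_tensor R S r s = tensor_kernel R S +>\<^bsub>pair_ring R S\<^esub> frag_of (r, s)"

text \<open>The image in \<open>R \<otimes> S\<close> of the tensor product of the additive subgroups \<open>A\<close> and \<open>B\<close>.\<close>

definition tensor_image ::
    "('a, 'x) ring_scheme \<Rightarrow> ('b, 'y) ring_scheme \<Rightarrow> 'a set \<Rightarrow> 'b set
      \<Rightarrow> ('a \<times> 'b \<Rightarrow>\<^sub>0 int) set set"
  where "tensor_image R S A B =
    generate (add_monoid (tensor_ring R S)) {pure_tensor R S a b | a b. a \<in> A \<and> b \<in> B}"

type_synonym 'a env = "('a \<times> 'a \<Rightarrow>\<^sub>0 int) set"

abbreviation env_ring :: "('a, 'x) ring_scheme \<Rightarrow> 'a env ring"
  where "env_ring R \<equiv> tensor_ring R (op_ring R)"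

abbreviation env_tensor :: "('a, 'x) ring_scheme \<Rightarrow> 'a \<Rightarrow> 'a \<Rightarrow> 'a env"
  where "env_tensor R r s \<equiv> pure_tensor R (op_ring R) r s"


section \<open>Bimodules and derivations\<close>

text \<open>
  As for the library's record \<^type>\<open>module\<close>, the fields \<open>mult\<close> and \<open>one\<close> inherited from rings
  carry no meaning in a bimodule.
\<close>

record ('a, 'm) bimodule = "'m ring" +
  lsmult :: "'a \<Rightarrow> 'm \<Rightarrow> 'm"
  rsmult :: "'m \<Rightarrow> 'a \<Rightarrow> 'm"

locale bimodule = R?: ring R + M?: abelian_group M
    for R :: "('a, 'x) ring_scheme" (structure) and M :: "('a, 'm, 'y) bimodule_scheme" (structure) +
  assumes lsmult_closed: "\<lbrakk>r \<in> carrier R; x \<in> carrier M\<rbrakk> \<Longrightarrow> lsmult M r x \<in> carrier M"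
    and rsmult_closed: "\<lbrakk>x \<in> carrier M; r \<in> carrier R\<rbrakk> \<Longrightarrow> rsmult M x r \<in> carrier M"
    and lsmult_l_distr: "\<lbrakk>r \<in> carrier R; s \<in> carrier R; x \<in> carrier M\<rbrakk> \<Longrightarrow>
      lsmult M (r \<oplus> s) x = lsmult M r x \<oplus>\<^bsub>M\<^esub> lsmult M s x"
    and lsmult_r_distr: "\<lbrakk>r \<in> carrier R; x \<in> carrier M; y \<in> carrier M\<rbrakk> \<Longrightarrow>
      lsmult M r (x \<oplus>\<^bsub>M\<^esub> y) = lsmult M r x \<oplus>\<^bsub>M\<^esub> lsmult M r y"
    and rsmult_l_distr: "\<lbrakk>x \<in> carrier M; y \<in> carrier M; r \<in> carrier R\<rbrakk> \<Longrightarrow>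
      rsmult M (x \<oplus>\<^bsub>M\<^esub> y) r = rsmult M x r \<oplus>\<^bsub>M\<^esub> rsmult M y r"
    and rsmult_r_distr: "\<lbrakk>x \<in> carrier M; r \<in> carrier R; s \<in> carrier R\<rbrakk> \<Longrightarrow>
      rsmult M x (r \<oplus> s) = rsmult M x r \<oplus>\<^bsub>M\<^esub> rsmult M x s"
    and lsmult_assoc: "\<lbrakk>r \<in> carrier R; s \<in> carrier R; x \<in> carrier M\<rbrakk> \<Longrightarrow>
      lsmult M (r \<otimes> s) x = lsmult M r (lsmult M s x)"
    and rsmult_assoc: "\<lbrakk>x \<in> carrier M; r \<in> carrier R; s \<in> carrier R\<rbrakk> \<Longrightarrow>
      rsmult M x (r \<otimes> s) = rsmult M (rsmult M x r) s"
    and lrsmult_assoc: "\<lbrakk>r \<in> carrier R; x \<in> carrier M; s \<in> carrier R\<rbrakk> \<Longrightarrow>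
      rsmult M (lsmult M r x) s = lsmult M r (rsmult M x s)"
    and lsmult_one: "x \<in> carrier M \<Longrightarrow> lsmult M \<one> x = x"
    and rsmult_one: "x \<in> carrier M \<Longrightarrow> rsmult M x \<one> = x"

definition regular_bimodule :: "('a, 'x) ring_scheme \<Rightarrow> ('a, 'a) bimodule"
  where "regular_bimodule R =
    \<lparr>carrier = carrier R, mult = mult R, one = one R, zero = zero R, add = add R,
     lsmult = mult R, rsmult = mult R\<rparr>"

definition ring_derivation :: "('a, 'x) ring_scheme \<Rightarrow> ('a \<Rightarrow> 'a) \<Rightarrow> bool"
  where "ring_derivation R \<delta> \<longleftrightarrow>
    \<delta> \<in> carrier R \<rightarrow> carrier R \<and>
    (\<forall>r\<in>carrier R. \<forall>s\<in>carrier R. \<delta> (r \<oplus>\<^bsub>R\<^esub> s) = \<delta> r \<oplus>\<^bsub>R\<^esub> \<delta> s) \<and>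
    (\<forall>r\<in>carrier R. \<forall>s\<in>carrier R. \<delta> (r \<otimes>\<^bsub>R\<^esub> s) = \<delta> r \<otimes>\<^bsub>R\<^esub> s \<oplus>\<^bsub>R\<^esub> r \<otimes>\<^bsub>R\<^esub> \<delta> s)"

definition bimodule_derivation ::
    "('a, 'x) ring_scheme \<Rightarrow> ('a, 'm, 'y) bimodule_scheme \<Rightarrow> ('a \<Rightarrow> 'a) \<Rightarrow> ('m \<Rightarrow> 'm) \<Rightarrow> bool"
  where "bimodule_derivation R M \<delta> d \<longleftrightarrow>
    d \<in> carrier M \<rightarrow> carrier M \<and>
    (\<forall>x\<in>carrier M. \<forall>y\<in>carrier M. d (x \<oplus>\<^bsub>M\<^esub> y) = d x \<oplus>\<^bsub>M\<^esub> d y) \<and>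
    (\<forall>x\<in>carrier M. \<forall>r\<in>carrier R. d (rsmult M x r) = rsmult M (d x) r \<oplus>\<^bsub>M\<^esub> rsmult M x (\<delta> r)) \<and>
    (\<forall>x\<in>carrier M. \<forall>r\<in>carrier R. d (lsmult M r x) = lsmult M (\<delta> r) x \<oplus>\<^bsub>M\<^esub> lsmult M r (d x))"

text \<open>
  A bimodule as a right module over \<open>R \<otimes> R\<^sup>o\<^sup>p\<close> via \<open>x (r \<otimes> s) = s x r\<close>. Here and below a right
  module is encoded in the library's record \<^type>\<open>module\<close> by letting \<open>t \<odot> x\<close> stand for
  \<open>x t\<close>, so that \<open>(t u) \<odot> x = u \<odot> (t \<odot> x)\<close>.
\<close>

definition formal_smult ::
    "('a, 'm, 'y) bimodule_scheme \<Rightarrow> ('a \<times> 'a \<Rightarrow>\<^sub>0 int) \<Rightarrow> 'm \<Rightarrow> 'm"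
  where "formal_smult M c x =
    (\<Oplus>\<^bsub>M\<^esub>p\<in>Poly_Mapping.keys c.
       [Poly_Mapping.lookup c p] \<cdot>\<^bsub>M\<^esub> lsmult M (snd p) (rsmult M x (fst p)))"

definition env_module ::
    "('a, 'x) ring_scheme \<Rightarrow> ('a, 'm, 'y) bimodule_scheme \<Rightarrow> ('a env, 'm) module"
  where "env_module R M =
    \<lparr>carrier = carrier M, mult = mult M, one = one M, zero = zero M, add = add M,
     smult = (\<lambda>t x. the_elem ((\<lambda>c. formal_smult M c x) ` t))\<rparr>"


section \<open>Gabriel filters\<close>

locale right_ideal = additive_subgroup I R + ring R for I and R (structure) +
  assumes I_r_closed: "\<lbrakk>a \<in> I; x \<in> carrier R\<rbrakk> \<Longrightarrow> a \<otimes> x \<in> I"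

definition residual :: "('a, 'x) ring_scheme \<Rightarrow> 'a set \<Rightarrow> 'a \<Rightarrow> 'a set"
  where "residual R I a = {x \<in> carrier R. a \<otimes>\<^bsub>R\<^esub> x \<in> I}"

definition right_gabriel_filter :: "('a, 'x) ring_scheme \<Rightarrow> 'a set set \<Rightarrow> bool"
  where "right_gabriel_filter R F \<longleftrightarrow>
    F \<noteq> {} \<and>
    (\<forall>I\<in>F. right_ideal I R) \<and>
    (\<forall>I\<in>F. \<forall>J. right_ideal J R \<and> I \<subseteq> J \<longrightarrow> J \<in> F) \<and>
    (\<forall>I\<in>F. \<forall>J\<in>F. I \<inter> J \<in> F) \<and>
    (\<forall>I\<in>F. \<forall>a\<in>carrier R. residual R I a \<in> F) \<and>
    (\<forall>I J. right_ideal I R \<and> J \<in> F \<and> (\<forall>a\<in>J. residual R I a \<in> F) \<longrightarrow> I \<in> F)"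

text \<open>Left ideals of \<open>R\<close> are right ideals of \<open>R\<^sup>o\<^sup>p\<close>.\<close>

definition left_gabriel_filter :: "('a, 'x) ring_scheme \<Rightarrow> 'a set set \<Rightarrow> bool"
  where "left_gabriel_filter R F \<longleftrightarrow> right_gabriel_filter (op_ring R) F"

definition induced_symmetric_filter ::
    "('a, 'x) ring_scheme \<Rightarrow> 'a set set \<Rightarrow> 'a set set \<Rightarrow> 'a env set set"
  where "induced_symmetric_filter R Fl Fr =
    {K. right_ideal K (env_ring R) \<and>
        (\<exists>I\<in>Fl. \<exists>J\<in>Fr.
           tensor_image R (op_ring R) J (carrier R)
             <+>\<^bsub>env_ring R\<^esub> tensor_image R (op_ring R) (carrier R) I \<subseteq> K)}"

definition symmetric_filter :: "('a, 'x) ring_scheme \<Rightarrow> 'a env set set \<Rightarrow> bool"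
  where "symmetric_filter R F \<longleftrightarrow>
    (\<exists>Fl Fr. left_gabriel_filter R Fl \<and> right_gabriel_filter R Fr \<and>
       F = induced_symmetric_filter R Fl Fr)"

definition torsion :: "('t, 'x) ring_scheme \<Rightarrow> 't set set \<Rightarrow> ('t, 'n) module \<Rightarrow> 'n set"
  where "torsion S F N = {x \<in> carrier N. {t \<in> carrier S. t \<odot>\<^bsub>N\<^esub> x = \<zero>\<^bsub>N\<^esub>} \<in> F}"

definition symmetric_torsion ::
    "('a, 'x) ring_scheme \<Rightarrow> 'a env set set \<Rightarrow> ('a, 'm, 'y) bimodule_scheme \<Rightarrow> 'm set"
  where "symmetric_torsion R F M = torsion (env_ring R) F (env_module R M)"

definition torsion_free ::
    "('a, 'x) ring_scheme \<Rightarrow> 'a env set set \<Rightarrow> ('a, 'm, 'y) bimodule_scheme \<Rightarrow> bool"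
  where "torsion_free R F M \<longleftrightarrow> symmetric_torsion R F M = {\<zero>\<^bsub>M\<^esub>}"

definition faithful_filter :: "('a, 'x) ring_scheme \<Rightarrow> 'a env set set \<Rightarrow> bool"
  where "faithful_filter R F \<longleftrightarrow> torsion_free R F (regular_bimodule R)"

definition differential_filter :: "('a, 'x) ring_scheme \<Rightarrow> 'a env set set \<Rightarrow> bool"
  where "differential_filter R F \<longleftrightarrow>
    (\<forall>I\<in>F. \<exists>J\<in>F. \<forall>\<delta>. ring_derivation (env_ring R) \<delta> \<longrightarrow> \<delta> ` J \<subseteq> I)"


section \<open>Modules of quotients\<close>

definition quotient_module :: "('t, 'n) module \<Rightarrow> 'n set \<Rightarrow> ('t, 'n set) module"
  where "quotient_module N T =
    \<lparr>carrier = a_rcosets\<^bsub>N\<^esub> T, mult = undefined, one = undefined,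
     zero = T, add = set_add N,
     smult = (\<lambda>t X. \<Union>x\<in>X. T +>\<^bsub>N\<^esub> (t \<odot>\<^bsub>N\<^esub> x))\<rparr>"

text \<open>As with the library's \<^const>\<open>hom\<close>, the values of a homomorphism outside \<open>K\<close> are arbitrary.\<close>

definition right_module_hom ::
    "('t, 'x) ring_scheme \<Rightarrow> 't set \<Rightarrow> ('t, 'n) module \<Rightarrow> ('t \<Rightarrow> 'n) set"
  where "right_module_hom S K N =
    {f \<in> K \<rightarrow> carrier N.
       (\<forall>t\<in>K. \<forall>u\<in>K. f (t \<oplus>\<^bsub>S\<^esub> u) = f t \<oplus>\<^bsub>N\<^esub> f u) \<and>
       (\<forall>t\<in>K. \<forall>u\<in>carrier S. f (t \<otimes>\<^bsub>S\<^esub> u) = u \<odot>\<^bsub>N\<^esub> f t)}"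

definition partial_homs ::
    "('t, 'x) ring_scheme \<Rightarrow> 't set set \<Rightarrow> ('t, 'n) module \<Rightarrow> ('t set \<times> ('t \<Rightarrow> 'n)) set"
  where "partial_homs S F N = (SIGMA K:F. right_module_hom S K N)"

text \<open>
  The direct limit of the groups \<open>Hom(K, N)\<close> over \<open>K \<in> F\<close>: two homomorphisms are identified if
  they coincide on a member of \<open>F\<close> contained in both domains.
\<close>

definition germ_rel ::
    "('t, 'x) ring_scheme \<Rightarrow> 't set set \<Rightarrow> ('t, 'n) module
      \<Rightarrow> (('t set \<times> ('t \<Rightarrow> 'n)) \<times> ('t set \<times> ('t \<Rightarrow> 'n))) set"
  where "germ_rel S F N =
    {((K, f), (L, g)). (K, f) \<in> partial_homs S F N \<and> (L, g) \<in> partial_homs S F N \<and>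
       (\<exists>D\<in>F. D \<subseteq> K \<inter> L \<and> (\<forall>t\<in>D. f t = g t))}"

type_synonym ('t, 'n) germ = "('t set \<times> ('t \<Rightarrow> 'n)) set"

definition germ ::
    "('t, 'x) ring_scheme \<Rightarrow> 't set set \<Rightarrow> ('t, 'n) module \<Rightarrow> 't set \<Rightarrow> ('t \<Rightarrow> 'n) \<Rightarrow> ('t, 'n) germ"
  where "germ S F N K f = germ_rel S F N `` {(K, f)}"

text \<open>
  The right \<open>S\<close>-module structure on the limit: the class of \<open>f : K \<rightarrow> N\<close> times \<open>s\<close> is the class of
  \<open>u \<mapsto> f (s u)\<close> on \<open>(K : s)\<close>.
\<close>

definition limit_module ::
    "('t, 'x) ring_scheme \<Rightarrow> 't set set \<Rightarrow> ('t, 'n) module \<Rightarrow> ('t, ('t, 'n) germ) module"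
  where "limit_module S F N =
    \<lparr>carrier = partial_homs S F N // germ_rel S F N, mult = undefined, one = undefined,
     zero = germ S F N (carrier S) (\<lambda>t. \<zero>\<^bsub>N\<^esub>),
     add = (\<lambda>X Y. \<Union>(K, f)\<in>X. \<Union>(L, g)\<in>Y. germ S F N (K \<inter> L) (\<lambda>t. f t \<oplus>\<^bsub>N\<^esub> g t)),
     smult = (\<lambda>s X. \<Union>(K, f)\<in>X. germ S F N (residual S K s) (\<lambda>u. f (s \<otimes>\<^bsub>S\<^esub> u)))\<rparr>"

definition torsion_quotient ::
    "('a, 'x) ring_scheme \<Rightarrow> 'a env set set \<Rightarrow> ('a, 'm, 'y) bimodule_scheme
      \<Rightarrow> ('a env, 'm set) module"
  where "torsion_quotient R F M = quotient_module (env_module R M) (symmetric_torsion R F M)"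

definition symmetric_limit ::
    "('a, 'x) ring_scheme \<Rightarrow> 'a env set set \<Rightarrow> ('a, 'm, 'y) bimodule_scheme
      \<Rightarrow> ('a env, ('a env, 'm set) germ) module"
  where "symmetric_limit R F M = limit_module (env_ring R) F (torsion_quotient R F M)"

text \<open>
  The bimodule structure corresponding to the right \<open>R \<otimes> R\<^sup>o\<^sup>p\<close>-module structure:
  \<open>s X = X (1 \<otimes> s)\<close> and \<open>X r = X (r \<otimes> 1)\<close>.
\<close>

definition symmetric_quotients ::
    "('a, 'x) ring_scheme \<Rightarrow> 'a env set set \<Rightarrow> ('a, 'm, 'y) bimodule_scheme
      \<Rightarrow> ('a, ('a env, 'm set) germ) bimodule"
  where "symmetric_quotients R F M =
    (let Q = symmetric_limit R F M in
     \<lparr>carrier = carrier Q, mult = mult Q, one = one Q, zero = zero Q, add = add Q,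
      lsmult = (\<lambda>s X. env_tensor R \<one>\<^bsub>R\<^esub> s \<odot>\<^bsub>Q\<^esub> X),
      rsmult = (\<lambda>X r. env_tensor R r \<one>\<^bsub>R\<^esub> \<odot>\<^bsub>Q\<^esub> X)\<rparr>)"

definition quotient_map ::
    "('a, 'x) ring_scheme \<Rightarrow> 'a env set set \<Rightarrow> ('a, 'm, 'y) bimodule_scheme
      \<Rightarrow> 'm \<Rightarrow> ('a env, 'm set) germ"
  where "quotient_map R F M m =
    (let N = torsion_quotient R F M in
     germ (env_ring R) F N (carrier (env_ring R))
       (\<lambda>t. t \<odot>\<^bsub>N\<^esub> (symmetric_torsion R F M +>\<^bsub>M\<^esub> m)))"

definition torsion_projection ::
    "('a, 'x) ring_scheme \<Rightarrow> 'a env set set \<Rightarrow> ('a, 'm, 'y) bimodule_scheme \<Rightarrow> 'm set \<Rightarrow> 'm set"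
  where "torsion_projection R F M X = (\<Union>x\<in>X. symmetric_torsion R F M +>\<^bsub>M\<^esub> x)"

definition quotient_comparison ::
    "('a, 'x) ring_scheme \<Rightarrow> 'a env set set \<Rightarrow> ('a, 'm, 'y) bimodule_scheme
      \<Rightarrow> ('a env, 'm set) germ \<Rightarrow> ('a env, 'm set) germ"
  where "quotient_comparison R F2 M X =
    (\<Union>(K, f)\<in>X. germ (env_ring R) F2 (torsion_quotient R F2 M) K (\<lambda>t. torsion_projection R F2 M (f t)))"


section \<open>Extensions of derivations\<close>

definition extends_to ::
    "('a, 'x) ring_scheme \<Rightarrow> 'a env set set \<Rightarrow> ('a, 'm, 'y) bimodule_scheme \<Rightarrow> ('a \<Rightarrow> 'a)
      \<Rightarrow> ('m \<Rightarrow> 'm) \<Rightarrow> (('a env, 'm set) germ \<Rightarrow> ('a env, 'm set) germ) \<Rightarrow> bool"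
  where "extends_to R F M \<delta> d d' \<longleftrightarrow>
    bimodule_derivation R (symmetric_quotients R F M) \<delta> d' \<and>
    (\<forall>m\<in>carrier M. d' (quotient_map R F M m) = quotient_map R F M (d m))"

definition extensions_agree ::
    "('a, 'x) ring_scheme \<Rightarrow> 'a env set set \<Rightarrow> 'a env set set \<Rightarrow> ('a, 'm, 'y) bimodule_scheme
      \<Rightarrow> ('a \<Rightarrow> 'a) \<Rightarrow> ('m \<Rightarrow> 'm) \<Rightarrow> bool"
  where "extensions_agree R F1 F2 M \<delta> d \<longleftrightarrow>
    (\<exists>d1 d2. extends_to R F1 M \<delta> d d1 \<and> extends_to R F2 M \<delta> d d2 \<and>
       (\<forall>X\<in>carrier (symmetric_quotients R F1 M).
          d2 (quotient_comparison R F2 M X) = quotient_comparison R F2 M (d1 X)))"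


section \<open>Well-definedness of the tensor product and of its action on bimodules\<close>

lemma carrier_pair_ring:
  "c \<in> carrier (pair_ring R S) \<longleftrightarrow> Poly_Mapping.keys c \<subseteq> carrier R \<times> carrier S"
  by (simp add: pair_ring_def)

lemma add_monoid_pair_ring:
  "add_monoid (pair_ring R S) = free_Abelian_group (carrier R \<times> carrier S)"
  by (simp add: pair_ring_def free_Abelian_group_def)

lemma frag_cmul_diff: "frag_cmul k (a - b) = frag_cmul k a - frag_cmul k b"
  by (metis add_diff_cancel diff_add_cancel frag_cmul_distrib2)

lemma frag_extend_sub: "frag_extend (\<lambda>x. f x - g x) c = frag_extend f c - frag_extend g c"
  by (simp add: frag_extend_def sum_subtractf frag_cmul_diff)

lemma frag_extend_plus: "frag_extend (\<lambda>x. f x + g x) c = frag_extend f c + frag_extend g c"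
  by (simp add: frag_extend_def sum.distrib frag_cmul_distrib2)

lemma mult_pair_simps:
  "mult (pair_ring R S) (a + a') b = mult (pair_ring R S) a b + mult (pair_ring R S) a' b"
  "mult (pair_ring R S) (a - a') b = mult (pair_ring R S) a b - mult (pair_ring R S) a' b"
  "mult (pair_ring R S) a (b + b') = mult (pair_ring R S) a b + mult (pair_ring R S) a b'"
  "mult (pair_ring R S) a (b - b') = mult (pair_ring R S) a b - mult (pair_ring R S) a b'"
  "mult (pair_ring R S) 0 b = 0" "mult (pair_ring R S) a 0 = 0"
  "mult (pair_ring R S) (frag_of (r, s)) (frag_of (r', s')) = frag_of (r \<otimes>\<^bsub>R\<^esub> r', s \<otimes>\<^bsub>S\<^esub> s')"
  by (simp_all add: pair_ring_def frag_extend_add frag_extend_diff split_def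
       frag_extend_plus frag_extend_sub frag_extend_eq_0)

lemma op_ring_simps [simp]:
  "carrier (op_ring R) = carrier R" "\<one>\<^bsub>op_ring R\<^esub> = \<one>\<^bsub>R\<^esub>" "\<zero>\<^bsub>op_ring R\<^esub> = \<zero>\<^bsub>R\<^esub>"
  "x \<oplus>\<^bsub>op_ring R\<^esub> y = x \<oplus>\<^bsub>R\<^esub> y" "x \<otimes>\<^bsub>op_ring R\<^esub> y = y \<otimes>\<^bsub>R\<^esub> x"
  by (simp_all add: op_ring_def)

lemma ring_op_ring: assumes "ring R" shows "ring (op_ring R)"
proof -
  interpret ring R by fact
  show ?thesis
  proof (rule ringI)
    show "abelian_group (op_ring R)"
      by (rule abelian_groupI) (auto simp: a_ac intro: a_inv_closed l_neg)
    show "monoid (op_ring R)" by (rule monoidI) (auto simp: m_assoc)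
  qed (auto simp: l_distr r_distr)
qed

lemma ring_pair_ring:
  assumes "ring R" "ring S"
  shows "ring (pair_ring R S)"
proof -
  interpret R: ring R by fact
  interpret S: ring S by fact
  let ?P = "pair_ring R S"
  have k: "Poly_Mapping.keys (a + b) \<subseteq> K" "Poly_Mapping.keys (a - b) \<subseteq> K"
    if "Poly_Mapping.keys a \<subseteq> K" "Poly_Mapping.keys b \<subseteq> K" for a b :: "'x \<Rightarrow>\<^sub>0 int" and K
    using that keys_add[of a b] keys_diff[of a b] by blast+
  have cl: "Poly_Mapping.keys (a \<otimes>\<^bsub>?P\<^esub> b) \<subseteq> carrier R \<times> carrier S"
    if "Poly_Mapping.keys a \<subseteq> carrier R \<times> carrier S" "Poly_Mapping.keys b \<subseteq> carrier R \<times> carrier S" for a b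
    using that(1)
  proof (induction a rule: frag_induction)
    case (one p)
    obtain r s where p: "p = (r, s)" by (cases p)
    show ?case using that(2)
      by (induction b rule: frag_induction) (use one in \<open>auto simp: p mult_pair_simps k\<close>)
  qed (auto simp: mult_pair_simps k)
  have as: "a \<otimes>\<^bsub>?P\<^esub> b \<otimes>\<^bsub>?P\<^esub> c = a \<otimes>\<^bsub>?P\<^esub> (b \<otimes>\<^bsub>?P\<^esub> c)"
    if "Poly_Mapping.keys a \<subseteq> carrier R \<times> carrier S" "Poly_Mapping.keys b \<subseteq> carrier R \<times> carrier S"
       "Poly_Mapping.keys c \<subseteq> carrier R \<times> carrier S" for a b c
    using that(1)
  proof (induction a rule: frag_induction)
    case (one p)
    show ?case using that(2)
    proof (induction b rule: frag_induction)
      case (one q)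
      show ?case using that(3)
        by (induction c rule: frag_induction)
          (use one \<open>p \<in> _\<close> in \<open>auto simp: mult_pair_simps R.m_assoc S.m_assoc\<close>)
    qed (auto simp: mult_pair_simps)
  qed (auto simp: mult_pair_simps)
  have o: "\<one>\<^bsub>?P\<^esub> = frag_of (\<one>\<^bsub>R\<^esub>, \<one>\<^bsub>S\<^esub>)" by (simp add: pair_ring_def)
  have u1: "\<one>\<^bsub>?P\<^esub> \<otimes>\<^bsub>?P\<^esub> a = a" if "Poly_Mapping.keys a \<subseteq> carrier R \<times> carrier S" for a
    using that by (induction a rule: frag_induction) (auto simp: mult_pair_simps o)
  have u2: "a \<otimes>\<^bsub>?P\<^esub> \<one>\<^bsub>?P\<^esub> = a" if "Poly_Mapping.keys a \<subseteq> carrier R \<times> carrier S" for a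
    using that by (induction a rule: frag_induction) (auto simp: mult_pair_simps o)
  have ad: "a \<oplus>\<^bsub>?P\<^esub> b = a + b" "\<zero>\<^bsub>?P\<^esub> = 0" for a b by (simp_all add: pair_ring_def)
  show ?thesis
  proof (rule ringI)
    show "abelian_group ?P"
    proof (rule abelian_groupI)
      fix x assume "x \<in> carrier ?P"
      then show "\<exists>y\<in>carrier ?P. y \<oplus>\<^bsub>?P\<^esub> x = \<zero>\<^bsub>?P\<^esub>"
        by (intro bexI[of _ "- x"]) (auto simp: ad carrier_pair_ring)
    qed (auto simp: carrier_pair_ring ad k ac_simps)
    show "monoid ?P"
      by (rule monoidI) (auto simp: carrier_pair_ring cl as u1 u2, auto simp: o)
  qed (auto simp: ad mult_pair_simps)
qed

lemma ideal_tensor_kernel: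
  assumes "ring R" "ring S"
  shows "ideal (tensor_kernel R S) (pair_ring R S)"
proof -
  interpret R: ring R by fact
  interpret S: ring S by fact
  interpret P: ring "pair_ring R S" by (rule ring_pair_ring) fact+
  let ?P = "pair_ring R S" and ?F = "free_Abelian_group (carrier R \<times> carrier S)" and ?I = "tensor_kernel R S"
  have sub: "tensor_relations R S \<subseteq> carrier ?F"
    unfolding tensor_relations_def
    by (auto dest!: subsetD [OF keys_diff])
  interpret F: comm_group ?F by (rule abelian_free_Abelian_group)
  have sg: "subgroup ?I ?F"
    unfolding tensor_kernel_def by (rule F.generate_is_subgroup[OF sub])
  have pl: "a + b \<in> ?I" if "a \<in> ?I" "b \<in> ?I" for a b
    using subgroup.m_closed[OF sg that] by simp
  have mi: "- a \<in> ?I" if "a \<in> ?I" for a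
    using subgroup.m_inv_closed[OF sg that] subgroup.mem_carrier[OF sg that] by simp
  have di: "a - b \<in> ?I" if "a \<in> ?I" "b \<in> ?I" for a b
    using pl[OF that(1) mi[OF that(2)]] by simp
  have z: "0 \<in> ?I" using subgroup.one_closed[OF sg] by simp
  have rel: "x \<in> ?I" if "x \<in> tensor_relations R S" for x
    using that unfolding tensor_kernel_def by (rule generate.incl)
  have A: "frag_of (r \<oplus>\<^bsub>R\<^esub> r', s) - frag_of (r, s) - frag_of (r', s) \<in> ?I"
    if "r \<in> carrier R" "r' \<in> carrier R" "s \<in> carrier S" for r r' s
    by (rule rel) (use that in \<open>auto simp: tensor_relations_def\<close>)
  have B: "frag_of (r, s \<oplus>\<^bsub>S\<^esub> s') - frag_of (r, s) - frag_of (r, s') \<in> ?I"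
    if "r \<in> carrier R" "s \<in> carrier S" "s' \<in> carrier S" for r s s'
    by (rule rel) (use that in \<open>auto simp: tensor_relations_def\<close>)
  have "x \<otimes>\<^bsub>?P\<^esub> a \<in> ?I \<and> a \<otimes>\<^bsub>?P\<^esub> x \<in> ?I"
    if x: "Poly_Mapping.keys x \<subseteq> carrier R \<times> carrier S" and "a \<in> ?I" for a x
    using that(2)[unfolded tensor_kernel_def]
  proof (induction a rule: generate.induct)
    case one
    then show ?case by (simp add: mult_pair_simps z)
  next
    case (incl h)
    show ?case using x
      by (induction x rule: frag_induction)
        (use incl in \<open>auto simp: tensor_relations_def mult_pair_simps z di A B
          R.r_distr S.r_distr R.l_distr S.l_distr
          right_diff_distrib intro!: \<close>, (simp_all add: algebra_simps di)?)
  next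
    case (inv h)
    have "x \<otimes>\<^bsub>?P\<^esub> h \<in> ?I \<and> h \<otimes>\<^bsub>?P\<^esub> x \<in> ?I" using x
      by (induction x rule: frag_induction)
        (use inv in \<open>auto simp: tensor_relations_def mult_pair_simps z di A B
          R.r_distr S.r_distr R.l_distr S.l_distr\<close>, (simp_all add: algebra_simps di)?)
    moreover have "x \<otimes>\<^bsub>?P\<^esub> (- h) = - (x \<otimes>\<^bsub>?P\<^esub> h)" "(- h) \<otimes>\<^bsub>?P\<^esub> x = - (h \<otimes>\<^bsub>?P\<^esub> x)"
      using mult_pair_simps(2)[of R S 0 h x] mult_pair_simps(4)[of R S x 0 h] by (simp_all add: mult_pair_simps)
    moreover have "h \<in> carrier ?F" using sub inv by blast
    ultimately show ?case by (simp add: mi)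
  next
    case (eng h1 h2)
    then show ?case by (simp add: mult_pair_simps pl)
  qed
  then show ?thesis
    using sg[folded add_monoid_pair_ring] by (intro idealI P.ring_axioms) (auto simp: carrier_pair_ring)
qed

lemma ring_tensor_ring: "\<lbrakk>ring R; ring S\<rbrakk> \<Longrightarrow> ring (tensor_ring R S)"
  unfolding tensor_ring_def by (rule ideal.quotient_is_ring[OF ideal_tensor_kernel])

lemma bimodule_regular: assumes "ring R" shows "bimodule R (regular_bimodule R)"
proof -
  interpret ring R by fact
  have "abelian_group (regular_bimodule R)"
    by (rule abelian_groupI) (auto simp: regular_bimodule_def a_ac intro: a_inv_closed l_neg)
  then show ?thesis
    by (intro bimodule.intro bimodule_axioms.intro assms)
       (auto simp: regular_bimodule_def l_distr r_distr m_assoc)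
qed


context bimodule begin

lemma formal_smult_superset:
  assumes "finite A" "Poly_Mapping.keys c \<subseteq> A" "A \<subseteq> carrier R \<times> carrier R" "x \<in> carrier M"
  shows "formal_smult M c x =
    (\<Oplus>\<^bsub>M\<^esub>p\<in>A. [Poly_Mapping.lookup c p] \<cdot>\<^bsub>M\<^esub> lsmult M (snd p) (rsmult M x (fst p)))"
  unfolding formal_smult_def
  by (rule M.add.finprod_mono_neutral_cong_left)
     (use assms in \<open>auto simp: in_keys_iff lsmult_closed rsmult_closed M.add.int_pow_closed subset_iff add_pow_def[of _ "0::int"]\<close>)

lemma formal_smult_add:
  assumes "Poly_Mapping.keys c \<subseteq> carrier R \<times> carrier R" "Poly_Mapping.keys c' \<subseteq> carrier R \<times> carrier R" "x \<in> carrier M"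
  shows "formal_smult M (c + c') x = formal_smult M c x \<oplus>\<^bsub>M\<^esub> formal_smult M c' x"
proof -
  let ?A = "Poly_Mapping.keys c \<union> Poly_Mapping.keys c'"
  let ?g = "\<lambda>p. lsmult M (snd p) (rsmult M x (fst p))"
  have g: "?g p \<in> carrier M" if "p \<in> ?A" for p
    using that assms by (auto intro!: lsmult_closed rsmult_closed)
  have "formal_smult M (c + c') x = (\<Oplus>\<^bsub>M\<^esub>p\<in>?A. [Poly_Mapping.lookup (c + c') p] \<cdot>\<^bsub>M\<^esub> ?g p)"
    by (rule formal_smult_superset) (use assms keys_add[of c c'] in auto)
  also have "\<dots> = (\<Oplus>\<^bsub>M\<^esub>p\<in>?A. [Poly_Mapping.lookup c p] \<cdot>\<^bsub>M\<^esub> ?g p \<oplus>\<^bsub>M\<^esub> [Poly_Mapping.lookup c' p] \<cdot>\<^bsub>M\<^esub> ?g p)"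
    by (rule M.finsum_cong') (use g in \<open>auto simp: lookup_add M.add.int_pow_mult\<close>)
  also have "\<dots> = (\<Oplus>\<^bsub>M\<^esub>p\<in>?A. [Poly_Mapping.lookup c p] \<cdot>\<^bsub>M\<^esub> ?g p) \<oplus>\<^bsub>M\<^esub> (\<Oplus>\<^bsub>M\<^esub>p\<in>?A. [Poly_Mapping.lookup c' p] \<cdot>\<^bsub>M\<^esub> ?g p)"
    by (rule M.finsum_addf) (use g in auto)
  also have "\<dots> = formal_smult M c x \<oplus>\<^bsub>M\<^esub> formal_smult M c' x"
    using assms by (subst (1 2) formal_smult_superset[of ?A]) auto
  finally show ?thesis .
qed

lemma formal_smult_closed:
  assumes "Poly_Mapping.keys c \<subseteq> carrier R \<times> carrier R" "x \<in> carrier M"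
  shows "formal_smult M c x \<in> carrier M"
  unfolding formal_smult_def
  by (rule M.finsum_closed) (use assms in \<open>auto simp: lsmult_closed rsmult_closed subset_iff\<close>)

lemma formal_smult_frag_of:
  assumes "r \<in> carrier R" "s \<in> carrier R" "x \<in> carrier M"
  shows "formal_smult M (frag_of (r, s)) x = lsmult M s (rsmult M x r)"
  using assms by (simp add: formal_smult_def M.add.finprod_singleton lsmult_closed rsmult_closed)

lemma formal_smult_diff:
  assumes "Poly_Mapping.keys c \<subseteq> carrier R \<times> carrier R" "Poly_Mapping.keys c' \<subseteq> carrier R \<times> carrier R" "x \<in> carrier M"
  shows "formal_smult M (c - c') x = formal_smult M c x \<ominus>\<^bsub>M\<^esub> formal_smult M c' x"
proof -
  have k: "Poly_Mapping.keys (c - c') \<subseteq> carrier R \<times> carrier R" using assms keys_diff[of c c'] by blast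
  have "formal_smult M c x = formal_smult M (c - c') x \<oplus>\<^bsub>M\<^esub> formal_smult M c' x"
    using formal_smult_add[OF k assms(2,3)] by simp
  with formal_smult_closed[OF k assms(3)] formal_smult_closed[OF assms(2,3)] show ?thesis
    by (simp add: M.minus_eq M.a_assoc M.r_neg)
qed

lemma formal_smult_relation:
  assumes "h \<in> tensor_relations R (op_ring R)" and x: "x \<in> carrier M"
  shows "Poly_Mapping.keys h \<subseteq> carrier R \<times> carrier R" "formal_smult M h x = \<zero>\<^bsub>M\<^esub>"
proof -
  show k: "Poly_Mapping.keys h \<subseteq> carrier R \<times> carrier R"
    using assms unfolding tensor_relations_def by (auto dest!: subsetD [OF keys_diff])
  have kk: "Poly_Mapping.keys (frag_of p - frag_of q) \<subseteq> carrier R \<times> carrier R"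
    if "p \<in> carrier R \<times> carrier R" "q \<in> carrier R \<times> carrier R" for p q
    using keys_diff[of "frag_of p" "frag_of q"] that by auto
  have e: "a \<oplus>\<^bsub>M\<^esub> b \<ominus>\<^bsub>M\<^esub> a \<ominus>\<^bsub>M\<^esub> b = \<zero>\<^bsub>M\<^esub>" if "a \<in> carrier M" "b \<in> carrier M" for a b
    using that by (metis M.a_inv_closed M.add.inv_solve_right M.minus_eq M.minus_closed M.a_comm
        M.r_neg M.add.m_closed)
  show "formal_smult M h x = \<zero>\<^bsub>M\<^esub>"
    using assms k unfolding tensor_relations_def
    by (auto simp: formal_smult_diff kk formal_smult_frag_of e lsmult_l_distr lsmult_r_distr
          rsmult_r_distr lsmult_closed rsmult_closed)
qed

lemma formal_smult_kernel:
  assumes "c \<in> tensor_kernel R (op_ring R)" and x: "x \<in> carrier M"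
  shows "Poly_Mapping.keys c \<subseteq> carrier R \<times> carrier R \<and> formal_smult M c x = \<zero>\<^bsub>M\<^esub>"
  using assms(1)[unfolded tensor_kernel_def]
proof (induction c rule: generate.induct)
  case one
  then show ?case by (simp add: formal_smult_def)
next
  case (incl h)
  with formal_smult_relation[of h x] x show ?case by simp
next
  case (inv h)
  with formal_smult_relation[of h x] formal_smult_diff[of 0 h x] x show ?case
    by (simp add: formal_smult_def[of _ 0] M.minus_eq)
next
  case (eng h1 h2)
  then show ?case using keys_add[of h1 h2] x by (auto simp: formal_smult_add)
qed

lemma env_module_pure_tensor:
  assumes "r \<in> carrier R" "s \<in> carrier R" "x \<in> carrier M"
  shows "env_tensor R r s \<odot>\<^bsub>env_module R M\<^esub> x = lsmult M s (rsmult M x r)"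
proof -
  have "formal_smult M c x = lsmult M s (rsmult M x r)" if "c \<in> env_tensor R r s" for c
  proof -
    from that obtain k where k: "k \<in> tensor_kernel R (op_ring R)" "c = k + frag_of (r, s)"
      by (auto simp: pure_tensor_def a_r_coset_def' pair_ring_def)
    show ?thesis using formal_smult_kernel[OF k(1) assms(3)] k(2) assms
      by (simp add: formal_smult_add formal_smult_frag_of lsmult_closed rsmult_closed)
  qed
  moreover have "0 + frag_of (r, s) \<in> env_tensor R r s"
    using generate.one[of "free_Abelian_group (carrier R \<times> carrier (op_ring R))" "tensor_relations R (op_ring R)"]
    by (auto simp: pure_tensor_def a_r_coset_def' pair_ring_def tensor_kernel_def)
  ultimately have "(\<lambda>c. formal_smult M c x) ` env_tensor R r s = {lsmult M s (rsmult M x r)}"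
    by (metis (no_types, lifting) image_cong image_constant_conv empty_iff)
  then show ?thesis by (simp add: env_module_def)
qed

end

end

theory Submission
  imports Defs
begin

text \<open>
  Let \<open>S = R \<otimes> R\<^sup>o\<^sup>p\<close>, let \<open>D\<close> be the derivation of \<open>S\<close> induced by \<open>\<delta>\<close>, and let \<open>F\<close> be a Gabriel
  filter on \<open>S\<close>. For \<open>K \<in> F\<close> the right ideal \<open>L = {t \<in> K. D t \<in> K}\<close> satisfies
  \<open>(K : D t) \<subseteq> (L : t)\<close> for all \<open>t \<in> K\<close>, so \<open>L \<in> F\<close> by transitivity of the filter: a single
  derivation is always compatible with \<open>F\<close>. Consequently \<open>d\<close> preserves the torsion submodule, and
  the class of \<open>t \<mapsto> d (f t) - f (D t)\<close> on \<open>L\<close>, for \<open>f\<close> defined on \<open>K\<close>, depends only on the class of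
  \<open>f\<close>. This gives extensions of \<open>d\<close> to all modules of quotients which commute with the comparison
  map of any two nested filters.

  A symmetric filter is Gabriel because a right ideal \<open>K\<close> belongs to it iff
  \<open>{r. r \<otimes> 1 \<in> K}\<close> and \<open>{s. 1 \<otimes> s \<in> K}\<close> belong to the two filters inducing it.
\<close>

text \<open>The formula for the extension is forced. The value \<open>f t\<close> stands for
  \<open>X t\<close>, where \<open>X\<close> is the class of \<open>f\<close>, so a map
  \<open>d'\<close> on classes that obeys the Leibniz rule over \<open>S\<close> has to satisfy
  \<open>d'(X) t = d'(X t) - X (D t)\<close>, and the right side is
  \<open>d (f t) - f (D t)\<close>. The obstacle is that \<open>D\<close> may move a point
  \<open>t\<close> of the domain \<open>K\<close> out of \<open>K\<close>, where \<open>f\<close>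
  says nothing. Shrinking \<open>K\<close> to \<open>L\<close> cures this. The same shrinking,
  applied to a set on which two representatives agree, makes them agree at \<open>D t\<close> as
  well, which gives independence of the representative. Agreement comes from the fact that
  \<open>D\<close> is fixed by \<open>\<delta>\<close> alone, whichever filter is used: the
  comparison map alters the values of \<open>f\<close> and leaves its arguments untouched. Treating
  bimodules as right \<open>S\<close>-modules merges the two one-sided Leibniz rules into one; they
  are recovered from the elements \<open>r \<otimes> 1\<close> and
  \<open>1 \<otimes> s\<close>.\<close>

section \<open>Additive maps, cosets and right ideals\<close>

lemma abelian_group_homI':
  assumes "abelian_group G" "abelian_group H" "h \<in> carrier G \<rightarrow> carrier H"
    and "\<And>x y. \<lbrakk>x \<in> carrier G; y \<in> carrier G\<rbrakk> \<Longrightarrow> h (x \<oplus>\<^bsub>G\<^esub> y) = h x \<oplus>\<^bsub>H\<^esub> h y"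
  shows "abelian_group_hom G H h"
proof -
  interpret G: abelian_group G by fact
  interpret H: abelian_group H by fact
  show ?thesis
    by (rule abelian_group_homI)
      (use assms in \<open>auto simp: group_hom_def group_hom_axioms_def hom_def
        G.a_group H.a_group\<close>)
qed

lemma (in abelian_group_hom) hom_minus:
  "\<lbrakk>x \<in> carrier G; y \<in> carrier G\<rbrakk> \<Longrightarrow> h (x \<ominus>\<^bsub>G\<^esub> y) = h x \<ominus>\<^bsub>H\<^esub> h y"
  by (simp add: G.minus_eq H.minus_eq)

lemma (in abelian_group) minus_add_minus:
  assumes "a \<in> carrier G" "b \<in> carrier G" "c \<in> carrier G" "d \<in> carrier G"
  shows "(a \<oplus> b) \<ominus> (c \<oplus> d) = (a \<ominus> c) \<oplus> (b \<ominus> d)"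
  using assms by (simp add: minus_eq minus_add a_ac)

text \<open>Read from right to left in \<open>limit_derivation_smult\<close>, where
  \<open>b \<oplus> c\<close> is the expansion of \<open>f (D (s \<otimes> t))\<close> by the
  product rule and \<open>b\<close> is the summand that cancels.\<close>

lemma (in abelian_group) minus_eq_minus_add:
  assumes "a \<in> carrier G" "b \<in> carrier G" "c \<in> carrier G"
  shows "a \<ominus> c = a \<ominus> (b \<oplus> c) \<oplus> b"
proof -
  have "a \<ominus> (b \<oplus> c) \<oplus> b = a \<oplus> (\<ominus> c \<oplus> (\<ominus> b \<oplus> b))"
    using assms by (simp only: minus_eq minus_add a_ac a_inv_closed a_closed)
  then show ?thesis using assms by (simp add: minus_eq l_neg)
qed

lemma (in abelian_group) additive_subgroup_imp_abelian_subgroup: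
  "additive_subgroup T G \<Longrightarrow> abelian_subgroup T G"
  by (simp add: abelian_group_axioms abelian_subgroupI3)

text \<open>The fields \<open>m\<close>, \<open>u\<close> and \<open>z\<close> are arbitrary so that
  the result fits \<open>quotient_module\<close>, where \<open>mult\<close> and \<open>one\<close>
  are \<open>undefined\<close> and the scalar action sits in the record extension.\<close>

lemma (in abelian_subgroup) abelian_group_coset_quotient:
  "abelian_group \<lparr>carrier = a_rcosets H, mult = m, one = u, zero = H, add = set_add G, \<dots> = z\<rparr>"
proof (rule abelian_groupI)
  have c: "\<exists>x\<in>carrier G. X = H +> x" if "X \<in> a_rcosets H" for X
    using that by (auto simp: A_RCOSETS_def')
  have r: "H +> x \<in> a_rcosets H" if "x \<in> carrier G" for x
    by (rule a_rcosetsI[OF a_subset that])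
  have z: "H = H +> \<zero>" by (simp add: a_subset)
  let ?Q = "\<lparr>carrier = a_rcosets H, mult = m, one = u, zero = H, add = set_add G, \<dots> = z\<rparr>"
  show "\<zero>\<^bsub>?Q\<^esub> \<in> carrier ?Q" using r[OF zero_closed] z by simp
  show "\<zero>\<^bsub>?Q\<^esub> \<oplus>\<^bsub>?Q\<^esub> X = X" if "X \<in> carrier ?Q" for X
    using that c[of X] by simp (metis z a_rcos_sum zero_closed l_zero)
  show "\<exists>Y\<in>carrier ?Q. Y \<oplus>\<^bsub>?Q\<^esub> X = \<zero>\<^bsub>?Q\<^esub>" if "X \<in> carrier ?Q" for X
    using that c[of X] by simp (metis z r a_rcos_sum a_inv_closed l_neg)
qed (auto simp: A_RCOSETS_def' a_rcos_sum a_ac)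

text \<open>Maps on quotients are defined here as unions over all representatives. Since
  \<open>h\<close> sends \<open>T\<close> into \<open>T'\<close>, every representative contributes
  the same coset, so the union collapses. This one fact serves the scalar action on
  \<open>quotient_module\<close>, the derivations induced on the tensor ring and on the torsion
  quotient, and the projection between torsion quotients.\<close>

lemma coset_map_apply:
  assumes "abelian_group_hom N N' h" "additive_subgroup T N" "additive_subgroup T' N'"
    and "h ` T \<subseteq> T'" "x \<in> carrier N"
  shows "(\<Union>y\<in>T +>\<^bsub>N\<^esub> x. T' +>\<^bsub>N'\<^esub> h y) = T' +>\<^bsub>N'\<^esub> h x"
proof -
  interpret h: abelian_group_hom N N' h by fact
  interpret T: abelian_subgroup T N
    by (rule h.G.additive_subgroup_imp_abelian_subgroup) fact
  interpret T': abelian_subgroup T' N'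
    by (rule h.H.additive_subgroup_imp_abelian_subgroup) fact
  have "T' +>\<^bsub>N'\<^esub> h y = T' +>\<^bsub>N'\<^esub> h x" if y: "y \<in> T +>\<^bsub>N\<^esub> x" for y
  proof -
    obtain t where t: "t \<in> T" "y = t \<oplus>\<^bsub>N\<^esub> x" using y by (auto simp: a_r_coset_def')
    have "h y = h t \<oplus>\<^bsub>N'\<^esub> h x" "h t \<in> T'"
      using t assms T.a_Hcarr by auto
    then have "h y \<in> T' +>\<^bsub>N'\<^esub> h x" by (auto simp: a_r_coset_def')
    then show ?thesis using T'.a_repr_independence'[of "h y" "h x"] assms by simp
  qed
  moreover have "x \<in> T +>\<^bsub>N\<^esub> x" using T.a_rcos_self assms by blast
  ultimately show ?thesis by blast
qed

lemma right_idealI: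
  assumes "ring S" "K \<subseteq> carrier S" "\<zero>\<^bsub>S\<^esub> \<in> K"
    and "\<And>t u. \<lbrakk>t \<in> K; u \<in> K\<rbrakk> \<Longrightarrow> t \<oplus>\<^bsub>S\<^esub> u \<in> K"
    and m: "\<And>t u. \<lbrakk>t \<in> K; u \<in> carrier S\<rbrakk> \<Longrightarrow> t \<otimes>\<^bsub>S\<^esub> u \<in> K"
  shows "right_ideal K S"
proof -
  interpret ring S by fact
  \<comment> \<open>Negation is right multiplication by \<open>\<ominus> \<one>\<close>, so it is
    covered by the closure under multiplication.\<close>
  have "\<ominus>\<^bsub>S\<^esub> t \<in> K" if "t \<in> K" for t
    using m[OF that, of "\<ominus>\<^bsub>S\<^esub> \<one>\<^bsub>S\<^esub>"] that assms(2) r_minus[of t "\<one>\<^bsub>S\<^esub>"] by auto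
  then have "additive_subgroup K S"
    using assms by (intro additive_subgroup.intro subgroup.intro) (auto simp flip: a_inv_def)
  then show ?thesis
    using assms by (intro right_ideal.intro right_ideal_axioms.intro) auto
qed

lemma (in ring) ring_derivation_hom:
  "ring_derivation R D \<Longrightarrow> abelian_group_hom R R D"
  by (rule abelian_group_homI') (auto simp: ring_derivation_def abelian_group_axioms)

lemma (in ring) ring_derivation_one:
  assumes "ring_derivation R D" shows "D \<one> = \<zero>"
proof -
  have c: "D \<one> \<in> carrier R" using assms by (auto simp: ring_derivation_def)
  have "D (\<one> \<otimes> \<one>) = D \<one> \<otimes> \<one> \<oplus> \<one> \<otimes> D \<one>"
    using assms one_closed unfolding ring_derivation_def by blast
  with c show ?thesis by simp
qed


section \<open>Gabriel filters\<close>

locale gabriel_filter = ring S for S (structure) +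
  fixes F assumes gabriel: "right_gabriel_filter S F"
begin

lemma filter_right_ideal: "K \<in> F \<Longrightarrow> right_ideal K S"
  and filter_up: "\<lbrakk>K \<in> F; right_ideal L S; K \<subseteq> L\<rbrakk> \<Longrightarrow> L \<in> F"
  and filter_Int: "\<lbrakk>K \<in> F; L \<in> F\<rbrakk> \<Longrightarrow> K \<inter> L \<in> F"
  and filter_residual: "\<lbrakk>K \<in> F; t \<in> carrier S\<rbrakk> \<Longrightarrow> residual S K t \<in> F"
  and filter_trans: "\<lbrakk>right_ideal K S; L \<in> F; \<And>t. t \<in> L \<Longrightarrow> residual S K t \<in> F\<rbrakk> \<Longrightarrow> K \<in> F"
  using gabriel unfolding right_gabriel_filter_def by blast+

lemma right_ideal_carrier: "right_ideal (carrier S) S"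
  by (rule right_idealI) (auto simp: ring_axioms)

lemma filter_subset: "K \<in> F \<Longrightarrow> K \<subseteq> carrier S"
  by (meson filter_right_ideal right_ideal_def additive_subgroup.a_subset)

lemma filter_elem: "\<lbrakk>K \<in> F; t \<in> K\<rbrakk> \<Longrightarrow> t \<in> carrier S"
  using filter_subset by blast

lemma filter_carrier: "carrier S \<in> F"
proof -
  have "F \<noteq> {}" using gabriel unfolding right_gabriel_filter_def by (rule conjunct1)
  then obtain K where K: "K \<in> F" by blast
  show ?thesis by (rule filter_up[OF K right_ideal_carrier filter_subset[OF K]])
qed

lemma filter_add_closed: "\<lbrakk>K \<in> F; t \<in> K; u \<in> K\<rbrakk> \<Longrightarrow> t \<oplus> u \<in> K"
  and filter_zero: "K \<in> F \<Longrightarrow> \<zero> \<in> K"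
  and filter_mult_closed: "\<lbrakk>K \<in> F; t \<in> K; u \<in> carrier S\<rbrakk> \<Longrightarrow> t \<otimes> u \<in> K"
  by (auto dest!: filter_right_ideal simp: right_ideal_def right_ideal_axioms_def
      additive_subgroup.zero_closed additive_subgroup.a_closed)

lemma filter_derivation_vimage:
  assumes D: "ring_derivation S D" and K: "K \<in> F"
  shows "{t \<in> K. D t \<in> K} \<in> F"
proof -
  interpret D: abelian_group_hom S S D by (rule ring_derivation_hom[OF D])
  let ?L = "{t \<in> K. D t \<in> K}"
  have prod: "D (t \<otimes> u) = D t \<otimes> u \<oplus> t \<otimes> D u" if "t \<in> carrier S" "u \<in> carrier S" for t u
    using D that by (auto simp: ring_derivation_def)
  note sub = subsetD[OF filter_subset[OF K]]
  have L: "right_ideal ?L S"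
    by (rule right_idealI)
      (auto simp: ring_axioms prod sub filter_zero filter_add_closed filter_mult_closed K)
  show ?thesis
  proof (rule filter_trans[OF L K])
    fix t assume t: "t \<in> K"
    have Lt: "right_ideal (residual S ?L t) S"
      using t by (intro right_idealI)
        (auto simp: residual_def ring_axioms prod sub filter_zero filter_add_closed r_distr
          filter_mult_closed K m_assoc[symmetric])
    \<comment> \<open>Let \<open>D t \<otimes> u\<close> be in \<open>K\<close>. Then
      \<open>t \<otimes> u\<close> is in \<open>K\<close> because \<open>t\<close> is, and in
      \<open>D (t \<otimes> u) = D t \<otimes> u \<oplus> t \<otimes> D u\<close> the first summand
      is in \<open>K\<close> by the choice of \<open>u\<close>, the second because \<open>K\<close>
      is a right ideal.\<close>
    have "residual S K (D t) \<subseteq> residual S ?L t"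
      using t by (auto simp: residual_def prod sub K intro!: filter_add_closed filter_mult_closed)
    then show "residual S ?L t \<in> F"
      using filter_up[OF filter_residual[OF K D.hom_closed[OF sub[OF t]]] Lt] by blast
  qed
qed

end


section \<open>Derivations on modules of quotients\<close>

locale right_module = S?: ring S + N?: abelian_group N
    for S :: "('t, 'x) ring_scheme" (structure) and N :: "('t, 'n) module" (structure) +
  assumes smult_closed: "\<lbrakk>t \<in> carrier S; x \<in> carrier N\<rbrakk> \<Longrightarrow> t \<odot>\<^bsub>N\<^esub> x \<in> carrier N"
    and smult_l_distr: "\<lbrakk>t \<in> carrier S; u \<in> carrier S; x \<in> carrier N\<rbrakk> \<Longrightarrow>
      (t \<oplus> u) \<odot>\<^bsub>N\<^esub> x = t \<odot>\<^bsub>N\<^esub> x \<oplus>\<^bsub>N\<^esub> u \<odot>\<^bsub>N\<^esub> x"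
    and smult_r_distr: "\<lbrakk>t \<in> carrier S; x \<in> carrier N; y \<in> carrier N\<rbrakk> \<Longrightarrow>
      t \<odot>\<^bsub>N\<^esub> (x \<oplus>\<^bsub>N\<^esub> y) = t \<odot>\<^bsub>N\<^esub> x \<oplus>\<^bsub>N\<^esub> t \<odot>\<^bsub>N\<^esub> y"
    and smult_assoc: "\<lbrakk>t \<in> carrier S; u \<in> carrier S; x \<in> carrier N\<rbrakk> \<Longrightarrow>
      (t \<otimes> u) \<odot>\<^bsub>N\<^esub> x = u \<odot>\<^bsub>N\<^esub> (t \<odot>\<^bsub>N\<^esub> x)"
begin

lemma smult_hom: "t \<in> carrier S \<Longrightarrow> abelian_group_hom N N (\<lambda>x. t \<odot>\<^bsub>N\<^esub> x)"
  by (rule abelian_group_homI') (auto simp: smult_closed smult_r_distr N.abelian_group_axioms)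

lemma smult_left_hom: "x \<in> carrier N \<Longrightarrow> abelian_group_hom S N (\<lambda>t. t \<odot>\<^bsub>N\<^esub> x)"
  by (rule abelian_group_homI')
    (auto simp: smult_closed smult_l_distr N.abelian_group_axioms S.abelian_group_axioms)

lemmas smult_zero = abelian_group_hom.hom_zero[OF smult_hom]
  and smult_minus = abelian_group_hom.hom_minus[OF smult_hom]
  and smult_left_zero = abelian_group_hom.hom_zero[OF smult_left_hom]

lemma right_module_quotient:
  assumes T: "additive_subgroup T N"
    and "\<And>t x. \<lbrakk>t \<in> carrier S; x \<in> T\<rbrakk> \<Longrightarrow> t \<odot>\<^bsub>N\<^esub> x \<in> T"
  shows "right_module S (quotient_module N T)"
    and "\<lbrakk>t \<in> carrier S; x \<in> carrier N\<rbrakk> \<Longrightarrow>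
      t \<odot>\<^bsub>quotient_module N T\<^esub> (T +>\<^bsub>N\<^esub> x) = T +>\<^bsub>N\<^esub> t \<odot>\<^bsub>N\<^esub> x"
proof -
  interpret T: abelian_subgroup T N
    by (rule N.additive_subgroup_imp_abelian_subgroup) fact
  show sm: "t \<odot>\<^bsub>quotient_module N T\<^esub> (T +>\<^bsub>N\<^esub> x) = T +>\<^bsub>N\<^esub> t \<odot>\<^bsub>N\<^esub> x"
    if "t \<in> carrier S" "x \<in> carrier N" for t x
    unfolding quotient_module_def
    using coset_map_apply[OF smult_hom[OF that(1)] T T _ that(2)] assms that by auto
  have car: "\<exists>x\<in>carrier N. X = T +>\<^bsub>N\<^esub> x" if "X \<in> carrier (quotient_module N T)" for X
    using that by (auto simp: quotient_module_def A_RCOSETS_def')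
  have cl: "T +>\<^bsub>N\<^esub> x \<in> carrier (quotient_module N T)" if "x \<in> carrier N" for x
    using that by (auto simp: quotient_module_def intro: N.a_rcosetsI[OF T.a_subset])
  have add: "(T +>\<^bsub>N\<^esub> x) \<oplus>\<^bsub>quotient_module N T\<^esub> (T +>\<^bsub>N\<^esub> y) = T +>\<^bsub>N\<^esub> (x \<oplus>\<^bsub>N\<^esub> y)"
    if "x \<in> carrier N" "y \<in> carrier N" for x y
    using that by (simp add: quotient_module_def T.a_rcos_sum)
  show "right_module S (quotient_module N T)"
  proof (intro right_module.intro right_module_axioms.intro)
    show "abelian_group (quotient_module N T)"
      unfolding quotient_module_def by (rule T.abelian_group_coset_quotient)
  qed (auto dest!: car simp: sm cl add smult_closed smult_l_distr smult_r_distr smult_assoc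
      S.ring_axioms)
qed

end

locale filtered_module = right_module S N + gabriel_filter S F
  for S :: "('t, 'x) ring_scheme" (structure) and N :: "('t, 'n) module" (structure) and F
begin

section \<open>Torsion submodules\<close>

lemma annihilator_right_ideal:
  "x \<in> carrier N \<Longrightarrow> right_ideal {t \<in> carrier S. t \<odot>\<^bsub>N\<^esub> x = \<zero>\<^bsub>N\<^esub>} S"
  by (rule right_idealI)
    (auto simp: S.ring_axioms smult_left_zero smult_l_distr smult_assoc smult_zero)

text \<open>It suffices that some member of the filter kills \<open>x\<close>: the annihilator is a
  right ideal containing that member, and filters are closed upwards. In this form torsion can be
  tested on any convenient member.\<close>

lemma torsion_iff:
  "x \<in> torsion S F N \<longleftrightarrow> x \<in> carrier N \<and> (\<exists>K\<in>F. \<forall>t\<in>K. t \<odot>\<^bsub>N\<^esub> x = \<zero>\<^bsub>N\<^esub>)"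
proof
  assume "x \<in> torsion S F N"
  then show "x \<in> carrier N \<and> (\<exists>K\<in>F. \<forall>t\<in>K. t \<odot>\<^bsub>N\<^esub> x = \<zero>\<^bsub>N\<^esub>)"
    unfolding torsion_def
    by (intro conjI bexI[of _ "{t \<in> carrier S. t \<odot>\<^bsub>N\<^esub> x = \<zero>\<^bsub>N\<^esub>}"]) simp_all
next
  assume r: "x \<in> carrier N \<and> (\<exists>K\<in>F. \<forall>t\<in>K. t \<odot>\<^bsub>N\<^esub> x = \<zero>\<^bsub>N\<^esub>)"
  then obtain K where "K \<in> F" "\<forall>t\<in>K. t \<odot>\<^bsub>N\<^esub> x = \<zero>\<^bsub>N\<^esub>" by blast
  then have "{t \<in> carrier S. t \<odot>\<^bsub>N\<^esub> x = \<zero>\<^bsub>N\<^esub>} \<in> F"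
    using filter_up[of K, OF _ annihilator_right_ideal, of x] filter_subset[of K] r by blast
  with r show "x \<in> torsion S F N" unfolding torsion_def by simp
qed

lemma torsionI:
  "\<lbrakk>x \<in> carrier N; K \<in> F; \<And>t. t \<in> K \<Longrightarrow> t \<odot>\<^bsub>N\<^esub> x = \<zero>\<^bsub>N\<^esub>\<rbrakk> \<Longrightarrow> x \<in> torsion S F N"
  unfolding torsion_iff by blast

lemma torsion_smult:
  assumes "t \<in> carrier S" "x \<in> torsion S F N"
  shows "t \<odot>\<^bsub>N\<^esub> x \<in> torsion S F N"
proof -
  from assms(2) obtain K where K: "x \<in> carrier N" "K \<in> F" "\<forall>t\<in>K. t \<odot>\<^bsub>N\<^esub> x = \<zero>\<^bsub>N\<^esub>"
    unfolding torsion_iff by blast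
  show ?thesis
  proof (rule torsionI[OF smult_closed filter_residual])
    fix u assume "u \<in> residual S K t"
    then show "u \<odot>\<^bsub>N\<^esub> (t \<odot>\<^bsub>N\<^esub> x) = \<zero>\<^bsub>N\<^esub>"
      using K assms(1) by (auto simp: residual_def simp flip: smult_assoc)
  qed (use K assms in auto)
qed

lemma torsion_additive_subgroup: "additive_subgroup (torsion S F N) N"
proof (intro additive_subgroup.intro subgroup.intro)
  have add: "x \<oplus>\<^bsub>N\<^esub> y \<in> torsion S F N"
    if xy: "x \<in> torsion S F N" "y \<in> torsion S F N" for x y
  proof -
    obtain K where K: "x \<in> carrier N" "K \<in> F" "\<forall>t\<in>K. t \<odot>\<^bsub>N\<^esub> x = \<zero>\<^bsub>N\<^esub>"
      using xy unfolding torsion_iff by blast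
    obtain L where L: "y \<in> carrier N" "L \<in> F" "\<forall>t\<in>L. t \<odot>\<^bsub>N\<^esub> y = \<zero>\<^bsub>N\<^esub>"
      using xy unfolding torsion_iff by blast
    show ?thesis
      by (rule torsionI[OF _ filter_Int[of K L]])
        (use K L in \<open>simp_all add: filter_elem[OF K(2)] smult_r_distr\<close>)
  qed
  then show "x \<otimes>\<^bsub>add_monoid N\<^esub> y \<in> torsion S F N"
    if "x \<in> torsion S F N" "y \<in> torsion S F N" for x y using that by simp
  show "inv\<^bsub>add_monoid N\<^esub> x \<in> torsion S F N" if x: "x \<in> torsion S F N" for x
  proof -
    obtain K where K: "x \<in> carrier N" "K \<in> F" "\<forall>t\<in>K. t \<odot>\<^bsub>N\<^esub> x = \<zero>\<^bsub>N\<^esub>"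
      using x unfolding torsion_iff by blast
    have "t \<odot>\<^bsub>N\<^esub> (\<ominus>\<^bsub>N\<^esub> x) = \<zero>\<^bsub>N\<^esub>" if "t \<in> K" for t
      using abelian_group_hom.hom_a_inv[OF smult_hom[OF filter_elem[OF K(2) that]] K(1)] K that
      by simp
    then have "\<ominus>\<^bsub>N\<^esub> x \<in> torsion S F N" using K by (intro torsionI[of _ K]) auto
    then show ?thesis by (simp add: a_inv_def)
  qed
  show "\<one>\<^bsub>add_monoid N\<^esub> \<in> torsion S F N"
    using torsionI[OF _ filter_carrier] by (simp add: smult_zero)
qed (auto simp: torsion_def)

section \<open>Germs and the direct limit\<close>

lemma germ_rel_equiv: "equiv (partial_homs S F N) (germ_rel S F N)"
proof (rule equivI)
  show "germ_rel S F N \<subseteq> partial_homs S F N \<times> partial_homs S F N"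
    by (auto simp: germ_rel_def)
  show "refl_on (partial_homs S F N) (germ_rel S F N)"
    by (rule refl_onI) (auto simp: germ_rel_def partial_homs_def)
  show "sym (germ_rel S F N)"
  proof (rule symI)
    fix X Y assume "(X, Y) \<in> germ_rel S F N"
    then show "(Y, X) \<in> germ_rel S F N"
      unfolding germ_rel_def by (simp add: split_def Int_commute) metis
  qed
  show "trans (germ_rel S F N)"
  proof (rule transI)
    fix X Y Z assume XY: "(X, Y) \<in> germ_rel S F N" "(Y, Z) \<in> germ_rel S F N"
    obtain K f L g P h where e: "X = (K, f)" "Y = (L, g)" "Z = (P, h)"
      by (metis prod.exhaust)
    from XY have p: "(K, f) \<in> partial_homs S F N" "(P, h) \<in> partial_homs S F N"
      unfolding germ_rel_def e by simp_all
    from XY(1) obtain C where C: "C \<in> F" "C \<subseteq> K \<inter> L" "\<forall>t\<in>C. f t = g t"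
      unfolding germ_rel_def e by auto
    from XY(2) obtain D where D: "D \<in> F" "D \<subseteq> L \<inter> P" "\<forall>t\<in>D. g t = h t"
      unfolding germ_rel_def e by auto
    have "C \<inter> D \<in> F" "C \<inter> D \<subseteq> K \<inter> P" "\<forall>t\<in>C \<inter> D. f t = h t"
      using C D filter_Int by auto
    with p show "(X, Z) \<in> germ_rel S F N" unfolding germ_rel_def e by blast
  qed
qed

lemma germ_eqI:
  assumes "(K, f) \<in> partial_homs S F N" "(L, g) \<in> partial_homs S F N"
    and "D \<in> F" "D \<subseteq> K \<inter> L" "\<And>t. t \<in> D \<Longrightarrow> f t = g t"
  shows "germ S F N K f = germ S F N L g"
  unfolding germ_def
  by (rule equiv_class_eq[OF germ_rel_equiv]) (use assms in \<open>auto simp: germ_rel_def\<close>)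

text \<open>All operations on germs are unions over representatives. Such a union reduces to the
  term of a chosen representative once \<open>\<Phi>\<close> cannot distinguish maps that agree on
  some member of the filter. The class is nonempty, so no value is lost.\<close>

lemma UN_germ:
  assumes "(K, f) \<in> partial_homs S F N"
    and "\<And>L g D. \<lbrakk>(L, g) \<in> partial_homs S F N; D \<in> F; D \<subseteq> K \<inter> L; \<And>t. t \<in> D \<Longrightarrow> f t = g t\<rbrakk>
      \<Longrightarrow> \<Phi> L g = \<Phi> K f"
  shows "(\<Union>(L, g)\<in>germ S F N K f. \<Phi> L g) = \<Phi> K f"
proof -
  have "germ S F N K f \<noteq> {}"
    using equiv_class_self[OF germ_rel_equiv assms(1)] unfolding germ_def by blast
  moreover have "\<Phi> L g = \<Phi> K f" if "(L, g) \<in> germ S F N K f" for L g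
  proof -
    have "((K, f), (L, g)) \<in> germ_rel S F N" using that by (simp add: germ_def)
    then obtain D where "(L, g) \<in> partial_homs S F N" "D \<in> F" "D \<subseteq> K \<inter> L" "\<forall>t\<in>D. f t = g t"
      unfolding germ_rel_def by auto
    then show ?thesis by (intro assms(2)[of L g D]) blast+
  qed
  ultimately show ?thesis by (intro SUP_eq_const) (simp_all add: split_paired_all)
qed

lemma germ_subset: "germ S F N K f \<subseteq> partial_homs S F N"
  by (auto simp: germ_def germ_rel_def)

lemma germ_closed: "(K, f) \<in> partial_homs S F N \<Longrightarrow> germ S F N K f \<in> carrier (limit_module S F N)"
  by (auto simp: limit_module_def germ_def intro: quotientI)

lemma limit_carrierE:
  assumes "X \<in> carrier (limit_module S F N)"
  obtains K f where "(K, f) \<in> partial_homs S F N" "X = germ S F N K f"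
  using assms by (auto simp: limit_module_def germ_def elim!: quotientE)

lemma partial_homs_iff:
  "(K, f) \<in> partial_homs S F N \<longleftrightarrow> K \<in> F \<and> (\<forall>t\<in>K. f t \<in> carrier N) \<and>
     (\<forall>t\<in>K. \<forall>u\<in>K. f (t \<oplus> u) = f t \<oplus>\<^bsub>N\<^esub> f u) \<and> (\<forall>t\<in>K. \<forall>u\<in>carrier S. f (t \<otimes> u) = u \<odot>\<^bsub>N\<^esub> f t)"
  by (auto simp: partial_homs_def right_module_hom_def)

lemma partial_homs_domain: "(K, f) \<in> partial_homs S F N \<Longrightarrow> K \<in> F"
  by (simp add: partial_homs_def)

lemma partial_homs_add:
  assumes "(K, f) \<in> partial_homs S F N" "(L, g) \<in> partial_homs S F N"
  shows "(K \<inter> L, \<lambda>t. f t \<oplus>\<^bsub>N\<^esub> g t) \<in> partial_homs S F N"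
  using assms by (auto simp: partial_homs_iff filter_Int smult_r_distr N.a_ac)

lemma limit_add:
  assumes f: "(K, f) \<in> partial_homs S F N" and g: "(L, g) \<in> partial_homs S F N"
  shows "germ S F N K f \<oplus>\<^bsub>limit_module S F N\<^esub> germ S F N L g
    = germ S F N (K \<inter> L) (\<lambda>t. f t \<oplus>\<^bsub>N\<^esub> g t)"
proof -
  \<comment> \<open>The inner union is collapsed for an arbitrary first representative
    \<open>f'\<close>, because the outer union still ranges over all of them.\<close>
  have "(\<Union>(L', g')\<in>germ S F N L g. germ S F N (K' \<inter> L') (\<lambda>t. f' t \<oplus>\<^bsub>N\<^esub> g' t))
    = germ S F N (K' \<inter> L) (\<lambda>t. f' t \<oplus>\<^bsub>N\<^esub> g t)" if f': "(K', f') \<in> partial_homs S F N" for K' f'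
  proof (rule UN_germ[OF g])
    fix L' g' D assume g': "(L', g') \<in> partial_homs S F N" "D \<in> F" "D \<subseteq> L \<inter> L'"
      "\<And>t. t \<in> D \<Longrightarrow> g t = g' t"
    show "germ S F N (K' \<inter> L') (\<lambda>t. f' t \<oplus>\<^bsub>N\<^esub> g' t) = germ S F N (K' \<inter> L) (\<lambda>t. f' t \<oplus>\<^bsub>N\<^esub> g t)"
      by (rule germ_eqI[OF partial_homs_add[OF f' g'(1)] partial_homs_add[OF f' g]
            filter_Int[OF partial_homs_domain[OF f'] g'(2)]])
        (use g' in auto)
  qed
  note inner = this
  have "germ S F N K f \<oplus>\<^bsub>limit_module S F N\<^esub> germ S F N L g =
    (\<Union>(K', f')\<in>germ S F N K f. \<Union>(L', g')\<in>germ S F N L g.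
      germ S F N (K' \<inter> L') (\<lambda>t. f' t \<oplus>\<^bsub>N\<^esub> g' t))"
    by (simp add: limit_module_def)
  also have "\<dots> = (\<Union>(K', f')\<in>germ S F N K f. germ S F N (K' \<inter> L) (\<lambda>t. f' t \<oplus>\<^bsub>N\<^esub> g t))"
  proof (intro SUP_cong refl)
    fix p assume "p \<in> germ S F N K f"
    then have "(fst p, snd p) \<in> partial_homs S F N" using germ_subset[of K f] by auto
    from inner[OF this] show "(case p of (K', f') \<Rightarrow> \<Union>(L', g')\<in>germ S F N L g.
        germ S F N (K' \<inter> L') (\<lambda>t. f' t \<oplus>\<^bsub>N\<^esub> g' t)) =
      (case p of (K', f') \<Rightarrow> germ S F N (K' \<inter> L) (\<lambda>t. f' t \<oplus>\<^bsub>N\<^esub> g t))"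
      by (simp add: split_def)
  qed
  also have "\<dots> = germ S F N (K \<inter> L) (\<lambda>t. f t \<oplus>\<^bsub>N\<^esub> g t)"
  proof (rule UN_germ[OF f])
    fix K' f' D assume f': "(K', f') \<in> partial_homs S F N" "D \<in> F" "D \<subseteq> K \<inter> K'"
      "\<And>t. t \<in> D \<Longrightarrow> f t = f' t"
    show "germ S F N (K' \<inter> L) (\<lambda>t. f' t \<oplus>\<^bsub>N\<^esub> g t) = germ S F N (K \<inter> L) (\<lambda>t. f t \<oplus>\<^bsub>N\<^esub> g t)"
      by (rule germ_eqI[OF partial_homs_add[OF f'(1) g] partial_homs_add[OF f g]
            filter_Int[OF f'(2) partial_homs_domain[OF g]]])
        (use f' in auto)
  qed
  finally show ?thesis .
qed

lemma partial_homs_smult: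
  assumes "s \<in> carrier S" "(K, f) \<in> partial_homs S F N"
  shows "(residual S K s, \<lambda>u. f (s \<otimes> u)) \<in> partial_homs S F N"
  using assms by (auto simp: partial_homs_iff filter_residual)
    (auto simp: residual_def S.r_distr simp flip: S.m_assoc)

lemma limit_smult:
  assumes s: "s \<in> carrier S" and f: "(K, f) \<in> partial_homs S F N"
  shows "s \<odot>\<^bsub>limit_module S F N\<^esub> germ S F N K f
    = germ S F N (residual S K s) (\<lambda>u. f (s \<otimes> u))"
proof -
  have "(\<Union>(K, f)\<in>germ S F N K f. germ S F N (residual S K s) (\<lambda>u. f (s \<otimes> u)))
    = germ S F N (residual S K s) (\<lambda>u. f (s \<otimes> u))"
  proof (rule UN_germ[OF f])
    fix L g D assume g: "(L, g) \<in> partial_homs S F N" "D \<in> F" "D \<subseteq> K \<inter> L"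
      "\<And>t. t \<in> D \<Longrightarrow> f t = g t"
    show "germ S F N (residual S L s) (\<lambda>u. g (s \<otimes> u)) = germ S F N (residual S K s) (\<lambda>u. f (s \<otimes> u))"
      by (rule germ_eqI[OF partial_homs_smult[OF s g(1)] partial_homs_smult[OF s f]
            filter_residual[OF g(2) s]])
        (use g in \<open>auto simp: residual_def\<close>)
  qed
  then show ?thesis by (simp add: limit_module_def)
qed

text \<open>Needed in \<open>extends_to_limit\<close>: the left Leibniz rule in
  \<open>bimodule_derivation\<close> lists its summands in the order opposite to
  \<open>limit_derivation_smult\<close>.\<close>

lemma limit_add_comm:
  assumes "X \<in> carrier (limit_module S F N)" "Y \<in> carrier (limit_module S F N)"
  shows "X \<oplus>\<^bsub>limit_module S F N\<^esub> Y = Y \<oplus>\<^bsub>limit_module S F N\<^esub> X"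
proof -
  obtain K f where X: "(K, f) \<in> partial_homs S F N" "X = germ S F N K f"
    using assms by (blast elim: limit_carrierE)
  obtain L g where Y: "(L, g) \<in> partial_homs S F N" "Y = germ S F N L g"
    using assms by (blast elim: limit_carrierE)
  note KL = partial_homs_domain[OF X(1)] partial_homs_domain[OF Y(1)]
  show ?thesis
    unfolding X(2) Y(2) limit_add[OF X(1) Y(1)] limit_add[OF Y(1) X(1)]
  proof (rule germ_eqI[OF partial_homs_add[OF X(1) Y(1)] partial_homs_add[OF Y(1) X(1)]
        filter_Int[OF KL]])
    fix t assume "t \<in> K \<inter> L"
    then have "f t \<in> carrier N" "g t \<in> carrier N"
      using X(1) Y(1) unfolding partial_homs_iff by auto
    then show "f t \<oplus>\<^bsub>N\<^esub> g t = g t \<oplus>\<^bsub>N\<^esub> f t" by (rule N.a_comm)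
  qed auto
qed

lemma limit_smult_closed:
  assumes "s \<in> carrier S" "X \<in> carrier (limit_module S F N)"
  shows "s \<odot>\<^bsub>limit_module S F N\<^esub> X \<in> carrier (limit_module S F N)"
  using assms(2)
proof (rule limit_carrierE)
  fix K f assume X: "(K, f) \<in> partial_homs S F N" "X = germ S F N K f"
  show ?thesis
    unfolding X(2) limit_smult[OF assms(1) X(1)]
    by (rule germ_closed[OF partial_homs_smult[OF assms(1) X(1)]])
qed

end

section \<open>Extension of a derivation to the limit\<close>

text \<open>The locale is used at two levels: for the module \<open>env_module R M\<close> with
  \<open>d\<close>, and for its torsion quotient with the induced map. The limit is formed over the
  latter.\<close>

locale derivation_module = filtered_module S N F
  for S :: "('t, 'x) ring_scheme" (structure) and N :: "('t, 'n) module" (structure) and F +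
  fixes D :: "'t \<Rightarrow> 't" and e :: "'n \<Rightarrow> 'n"
  assumes D: "ring_derivation S D"
    and e_closed: "x \<in> carrier N \<Longrightarrow> e x \<in> carrier N"
    and e_add: "\<lbrakk>x \<in> carrier N; y \<in> carrier N\<rbrakk> \<Longrightarrow> e (x \<oplus>\<^bsub>N\<^esub> y) = e x \<oplus>\<^bsub>N\<^esub> e y"
    and e_smult: "\<lbrakk>t \<in> carrier S; x \<in> carrier N\<rbrakk> \<Longrightarrow>
      e (t \<odot>\<^bsub>N\<^esub> x) = t \<odot>\<^bsub>N\<^esub> e x \<oplus>\<^bsub>N\<^esub> D t \<odot>\<^bsub>N\<^esub> x"
begin

sublocale D: abelian_group_hom S S D by (rule S.ring_derivation_hom[OF D])

sublocale e: abelian_group_hom N N e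
  by (rule abelian_group_homI') (auto simp: e_closed e_add N.abelian_group_axioms)

lemma D_mult: "\<lbrakk>t \<in> carrier S; u \<in> carrier S\<rbrakk> \<Longrightarrow> D (t \<otimes> u) = D t \<otimes> u \<oplus> t \<otimes> D u"
  using D by (auto simp: ring_derivation_def)

lemma torsion_derivation:
  assumes "x \<in> torsion S F N" shows "e x \<in> torsion S F N"
proof -
  from assms obtain K where K: "x \<in> carrier N" "K \<in> F" "\<forall>t\<in>K. t \<odot>\<^bsub>N\<^esub> x = \<zero>\<^bsub>N\<^esub>"
    unfolding torsion_iff by blast
  show ?thesis
  proof (rule torsionI[OF _ filter_derivation_vimage[OF D K(2)]])
    fix t assume t: "t \<in> {t \<in> K. D t \<in> K}"
    then have "t \<in> carrier S" "t \<odot>\<^bsub>N\<^esub> x = \<zero>\<^bsub>N\<^esub>" "D t \<odot>\<^bsub>N\<^esub> x = \<zero>\<^bsub>N\<^esub>"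
      using filter_elem[OF K(2)] K(3) by simp_all
    \<comment> \<open>Apply \<open>e\<close> to \<open>t \<odot> x\<close>, which is zero. The term
      \<open>D t \<odot> x\<close> vanishes too, so the Leibniz rule leaves only
      \<open>t \<odot> e x\<close>.\<close>
    with e_smult[of t x] K(1) show "t \<odot>\<^bsub>N\<^esub> e x = \<zero>\<^bsub>N\<^esub>" by (simp add: smult_closed)
  qed (use K e_closed in auto)
qed

definition limit_derivation :: "('t, 'n) germ \<Rightarrow> ('t, 'n) germ"
  where "limit_derivation X =
    (\<Union>(K, f)\<in>X. germ S F N {t \<in> K. D t \<in> K} (\<lambda>t. e (f t) \<ominus>\<^bsub>N\<^esub> f (D t)))"

lemma partial_homs_derivation:
  assumes f: "(K, f) \<in> partial_homs S F N"
  shows "({t \<in> K. D t \<in> K}, \<lambda>t. e (f t) \<ominus>\<^bsub>N\<^esub> f (D t)) \<in> partial_homs S F N"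
proof -
  have K: "K \<in> F" by (rule partial_homs_domain[OF f])
  note f = f[unfolded partial_homs_iff]
  note sub = subsetD[OF filter_subset[OF K]]
  show ?thesis
    unfolding partial_homs_iff
  proof (intro conjI ballI)
    \<comment> \<open>Expanding both terms at \<open>t \<otimes> u\<close>, the derivation
      \<open>e\<close> produces the cross term \<open>D u \<odot> f t\<close> from
      \<open>u \<odot> f t\<close>, and \<open>f\<close> produces the same one from
      \<open>t \<otimes> D u\<close>. The subtraction cancels them; this is what makes the new map
      linear.\<close>
    fix t u assume "t \<in> {t \<in> K. D t \<in> K}" "u \<in> carrier S"
    with f K show "e (f (t \<otimes> u)) \<ominus>\<^bsub>N\<^esub> f (D (t \<otimes> u)) = u \<odot>\<^bsub>N\<^esub> (e (f t) \<ominus>\<^bsub>N\<^esub> f (D t))"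
      by (simp add: D_mult sub e_smult smult_minus filter_mult_closed)
        (simp add: N.minus_eq N.minus_add smult_closed e_closed N.a_ac N.r_neg1 N.r_neg2
          N.r_neg)
  qed (use f K in \<open>auto simp: filter_derivation_vimage D sub N.minus_add_minus\<close>)
qed

text \<open>If \<open>f\<close> and \<open>g\<close> agree on \<open>C\<close>, the two derived maps
  agree at those \<open>t\<close> in \<open>C\<close> with \<open>D t\<close> also in
  \<open>C\<close>. By \<open>filter_derivation_vimage\<close> these form a member of the
  filter.\<close>

lemma limit_derivation_germ:
  assumes f: "(K, f) \<in> partial_homs S F N"
  shows "limit_derivation (germ S F N K f) =
    germ S F N {t \<in> K. D t \<in> K} (\<lambda>t. e (f t) \<ominus>\<^bsub>N\<^esub> f (D t))"
  unfolding limit_derivation_def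
proof (rule UN_germ[OF f])
  fix L g C assume g: "(L, g) \<in> partial_homs S F N" "C \<in> F" "C \<subseteq> K \<inter> L"
    "\<And>t. t \<in> C \<Longrightarrow> f t = g t"
  show "germ S F N {t \<in> L. D t \<in> L} (\<lambda>t. e (g t) \<ominus>\<^bsub>N\<^esub> g (D t))
    = germ S F N {t \<in> K. D t \<in> K} (\<lambda>t. e (f t) \<ominus>\<^bsub>N\<^esub> f (D t))"
    by (rule germ_eqI[OF partial_homs_derivation[OF g(1)] partial_homs_derivation[OF f]
          filter_derivation_vimage[OF D g(2)]])
      (use g in auto)
qed

lemma limit_derivation_closed:
  "X \<in> carrier (limit_module S F N) \<Longrightarrow> limit_derivation X \<in> carrier (limit_module S F N)"
  by (auto elim!: limit_carrierE simp: limit_derivation_germ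
      intro!: germ_closed[OF partial_homs_derivation])

lemma limit_derivation_add:
  assumes "X \<in> carrier (limit_module S F N)" "Y \<in> carrier (limit_module S F N)"
  shows "limit_derivation (X \<oplus>\<^bsub>limit_module S F N\<^esub> Y) =
    limit_derivation X \<oplus>\<^bsub>limit_module S F N\<^esub> limit_derivation Y"
proof -
  obtain K f where X: "(K, f) \<in> partial_homs S F N" "X = germ S F N K f"
    using assms by (blast elim: limit_carrierE)
  obtain L g where Y: "(L, g) \<in> partial_homs S F N" "Y = germ S F N L g"
    using assms by (blast elim: limit_carrierE)
  note KL = partial_homs_domain[OF X(1)] partial_homs_domain[OF Y(1)]
  note fg = partial_homs_add[OF X(1) Y(1)]
  note df = partial_homs_derivation[OF X(1)] and dg = partial_homs_derivation[OF Y(1)]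
  show ?thesis
    unfolding X(2) Y(2) limit_add[OF X(1) Y(1)] limit_derivation_germ[OF fg]
      limit_derivation_germ[OF X(1)] limit_derivation_germ[OF Y(1)] limit_add[OF df dg]
  proof (rule germ_eqI[OF partial_homs_derivation[OF fg] partial_homs_add[OF df dg]
        filter_derivation_vimage[OF D filter_Int[OF KL]]])
    fix t assume t: "t \<in> {t \<in> K \<inter> L. D t \<in> K \<inter> L}"
    then have "f t \<in> carrier N" "g t \<in> carrier N" "f (D t) \<in> carrier N" "g (D t) \<in> carrier N"
      using X(1) Y(1) unfolding partial_homs_iff by auto
    then show "e (f t \<oplus>\<^bsub>N\<^esub> g t) \<ominus>\<^bsub>N\<^esub> (f (D t) \<oplus>\<^bsub>N\<^esub> g (D t)) =
      e (f t) \<ominus>\<^bsub>N\<^esub> f (D t) \<oplus>\<^bsub>N\<^esub> (e (g t) \<ominus>\<^bsub>N\<^esub> g (D t))"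
      by (simp add: N.minus_add_minus e_closed)
  qed auto
qed

lemma limit_derivation_smult:
  assumes s: "s \<in> carrier S" and "X \<in> carrier (limit_module S F N)"
  shows "limit_derivation (s \<odot>\<^bsub>limit_module S F N\<^esub> X) =
    s \<odot>\<^bsub>limit_module S F N\<^esub> limit_derivation X \<oplus>\<^bsub>limit_module S F N\<^esub> D s \<odot>\<^bsub>limit_module S F N\<^esub> X"
proof -
  obtain K f where X: "(K, f) \<in> partial_homs S F N" "X = germ S F N K f"
    using assms by (blast elim: limit_carrierE)
  note f = X(1)[unfolded partial_homs_iff]
  have K: "K \<in> F" by (rule partial_homs_domain[OF X(1)])
  note sub = subsetD[OF filter_subset[OF K]]
  note Ds = D.hom_closed[OF s]
  note sf = partial_homs_smult[OF s X(1)] and Dsf = partial_homs_smult[OF Ds X(1)]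
  note df = partial_homs_derivation[OF X(1)]
  note sdf = partial_homs_smult[OF s df]
  \<comment> \<open>This is the domain of the sum on the right. It puts
    \<open>s \<otimes> t\<close>, \<open>D (s \<otimes> t)\<close> and
    \<open>D s \<otimes> t\<close> into \<open>K\<close>; the left side also evaluates
    \<open>f\<close> at \<open>s \<otimes> D t\<close>, hence the further demand that
    \<open>D t\<close> be in \<open>?L\<close>.\<close>
  let ?L = "residual S {t \<in> K. D t \<in> K} s \<inter> residual S K (D s)"
  have L: "{t \<in> ?L. D t \<in> ?L} \<in> F"
    by (intro filter_derivation_vimage D filter_Int filter_residual K s Ds)
  show ?thesis
    unfolding X(2) limit_smult[OF s X(1)] limit_smult[OF Ds X(1)] limit_derivation_germ[OF X(1)]
      limit_derivation_germ[OF sf] limit_smult[OF s df] limit_add[OF sdf Dsf]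
  proof (rule germ_eqI[OF partial_homs_derivation[OF sf] partial_homs_add[OF sdf Dsf] L])
    fix t assume t: "t \<in> {t \<in> ?L. D t \<in> ?L}"
    have c: "t \<in> carrier S" "s \<otimes> t \<in> K" "D s \<otimes> t \<in> K" "s \<otimes> D t \<in> K"
      using t by (auto simp: residual_def)
    \<comment> \<open>The two sides of the claim differ by using \<open>s \<otimes> D t\<close> or
      \<open>D (s \<otimes> t)\<close> as argument of the subtracted term; the product rule for
      \<open>D\<close> makes up the difference \<open>f (D s \<otimes> t)\<close>.\<close>
    have "f (D (s \<otimes> t)) = f (D s \<otimes> t) \<oplus>\<^bsub>N\<^esub> f (s \<otimes> D t)"
      using f c s by (simp add: D_mult)
    moreover have "f (s \<otimes> t) \<in> carrier N" "f (D s \<otimes> t) \<in> carrier N" "f (s \<otimes> D t) \<in> carrier N"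
      using f c by blast+
    ultimately show "e (f (s \<otimes> t)) \<ominus>\<^bsub>N\<^esub> f (s \<otimes> D t) =
      e (f (s \<otimes> t)) \<ominus>\<^bsub>N\<^esub> f (D (s \<otimes> t)) \<oplus>\<^bsub>N\<^esub> f (D s \<otimes> t)"
      by (simp add: e_closed flip: N.minus_eq_minus_add)
  qed (auto simp: residual_def)
qed

text \<open>The germ of \<open>t \<mapsto> t \<odot> x\<close> is the image of \<open>x\<close> in
  the limit, so the second part is the equation between the extension and the canonical map. It
  holds because \<open>e (t \<odot> x)\<close> minus \<open>D t \<odot> x\<close> is
  \<open>t \<odot> e x\<close>.\<close>

lemma germ_smult_left:
  assumes x: "x \<in> carrier N"
  shows "(carrier S, \<lambda>t. t \<odot>\<^bsub>N\<^esub> x) \<in> partial_homs S F N"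
    and "limit_derivation (germ S F N (carrier S) (\<lambda>t. t \<odot>\<^bsub>N\<^esub> x)) =
      germ S F N (carrier S) (\<lambda>t. t \<odot>\<^bsub>N\<^esub> e x)"
proof -
  have p: "(carrier S, \<lambda>t. t \<odot>\<^bsub>N\<^esub> x) \<in> partial_homs S F N" if "x \<in> carrier N" for x
    using that
    by (auto simp: partial_homs_iff filter_carrier smult_closed smult_l_distr smult_assoc)
  then show p': "(carrier S, \<lambda>t. t \<odot>\<^bsub>N\<^esub> x) \<in> partial_homs S F N" using x .
  show "limit_derivation (germ S F N (carrier S) (\<lambda>t. t \<odot>\<^bsub>N\<^esub> x)) =
      germ S F N (carrier S) (\<lambda>t. t \<odot>\<^bsub>N\<^esub> e x)"
    unfolding limit_derivation_germ[OF p']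
    by (rule germ_eqI[OF partial_homs_derivation[OF p'] p filter_carrier])
      (use x in \<open>auto simp: e_closed e_smult smult_closed N.minus_eq N.a_assoc N.r_neg\<close>)
qed

section \<open>The derivation induced on the torsion quotient\<close>

definition quotient_derivation :: "'n set \<Rightarrow> 'n set"
  where "quotient_derivation X = (\<Union>x\<in>X. torsion S F N +>\<^bsub>N\<^esub> e x)"

lemma quotient_derivation_coset:
  assumes "x \<in> carrier N"
  shows "quotient_derivation (torsion S F N +>\<^bsub>N\<^esub> x) = torsion S F N +>\<^bsub>N\<^esub> e x"
  unfolding quotient_derivation_def
  by (rule coset_map_apply[OF e.abelian_group_hom_axioms torsion_additive_subgroup
        torsion_additive_subgroup _ assms])
    (auto intro: torsion_derivation)

lemma quotient_carrier:
  "carrier (quotient_module N (torsion S F N)) = (\<lambda>x. torsion S F N +>\<^bsub>N\<^esub> x) ` carrier N"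
  by (auto simp: quotient_module_def A_RCOSETS_def')

lemma quotient_add:
  assumes "x \<in> carrier N" "y \<in> carrier N"
  shows "(torsion S F N +>\<^bsub>N\<^esub> x) \<oplus>\<^bsub>quotient_module N (torsion S F N)\<^esub> (torsion S F N +>\<^bsub>N\<^esub> y)
    = torsion S F N +>\<^bsub>N\<^esub> (x \<oplus>\<^bsub>N\<^esub> y)"
proof -
  interpret T: abelian_subgroup "torsion S F N" N
    by (rule N.additive_subgroup_imp_abelian_subgroup[OF torsion_additive_subgroup])
  show ?thesis using assms by (simp add: quotient_module_def T.a_rcos_sum)
qed

lemmas quotient_smult = right_module_quotient(2)[OF torsion_additive_subgroup torsion_smult]

text \<open>The Leibniz rule passes to cosets because the torsion submodule is stable both under the
  action and, by \<open>torsion_derivation\<close>, under \<open>e\<close>.\<close>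

lemma derivation_module_quotient:
  "derivation_module S (quotient_module N (torsion S F N)) F D quotient_derivation"
proof -
  interpret Q: right_module S "quotient_module N (torsion S F N)"
    by (rule right_module_quotient(1)[OF torsion_additive_subgroup torsion_smult])
  show ?thesis
  proof (intro derivation_module.intro filtered_module.intro derivation_module_axioms.intro)
    show "right_module S (quotient_module N (torsion S F N))" by (rule Q.right_module_axioms)
    show "gabriel_filter S F" by (rule gabriel_filter_axioms)
    show "ring_derivation S D" by (rule D)
  next
    fix X assume "X \<in> carrier (quotient_module N (torsion S F N))"
    then obtain x where x: "x \<in> carrier N" "X = torsion S F N +>\<^bsub>N\<^esub> x"
      unfolding quotient_carrier by blast
    show "quotient_derivation X \<in> carrier (quotient_module N (torsion S F N))"
      unfolding quotient_carrier x(2) quotient_derivation_coset[OF x(1)]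
      using e_closed[OF x(1)] by blast
    {
      fix Y assume "Y \<in> carrier (quotient_module N (torsion S F N))"
      then obtain y where y: "y \<in> carrier N" "Y = torsion S F N +>\<^bsub>N\<^esub> y"
        unfolding quotient_carrier by blast
      show "quotient_derivation (X \<oplus>\<^bsub>quotient_module N (torsion S F N)\<^esub> Y) =
        quotient_derivation X \<oplus>\<^bsub>quotient_module N (torsion S F N)\<^esub> quotient_derivation Y"
        using x(1) y(1) by (simp add: x(2) y(2) quotient_derivation_coset quotient_add e_closed e_add)
    }
    fix t assume t: "t \<in> carrier S"
    show "quotient_derivation (t \<odot>\<^bsub>quotient_module N (torsion S F N)\<^esub> X) =
      t \<odot>\<^bsub>quotient_module N (torsion S F N)\<^esub> quotient_derivation X
        \<oplus>\<^bsub>quotient_module N (torsion S F N)\<^esub> D t \<odot>\<^bsub>quotient_module N (torsion S F N)\<^esub> X"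
      using x(1) t
      by (simp add: x(2) quotient_derivation_coset quotient_smult smult_closed e_closed
          quotient_add e_smult)
  qed
qed

end

section \<open>Comparison of limits over nested filters\<close>

definition right_module_map ::
    "('t, 'x) ring_scheme \<Rightarrow> ('t, 'm) module \<Rightarrow> ('t, 'n) module \<Rightarrow> ('m \<Rightarrow> 'n) \<Rightarrow> bool"
  where "right_module_map S N1 N2 p \<longleftrightarrow>
    p \<in> carrier N1 \<rightarrow> carrier N2 \<and>
    (\<forall>x\<in>carrier N1. \<forall>y\<in>carrier N1. p (x \<oplus>\<^bsub>N1\<^esub> y) = p x \<oplus>\<^bsub>N2\<^esub> p y) \<and>
    (\<forall>t\<in>carrier S. \<forall>x\<in>carrier N1. p (t \<odot>\<^bsub>N1\<^esub> x) = t \<odot>\<^bsub>N2\<^esub> p x)"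

text \<open>Composition with \<open>p\<close> keeps the domain \<open>K\<close>. The inclusion of
  filters is what makes \<open>K\<close> an admissible domain on the other side, and likewise the
  sets on which two representatives agree.\<close>

lemma limit_map_germ:
  assumes N1: "filtered_module S N1 F1" and N2: "filtered_module S N2 F2" and F: "F1 \<subseteq> F2"
    and p: "right_module_map S N1 N2 p"
    and f: "(K, f) \<in> partial_homs S F1 N1"
  shows "(K, \<lambda>t. p (f t)) \<in> partial_homs S F2 N2"
    and "(\<Union>(K, f)\<in>germ S F1 N1 K f. germ S F2 N2 K (\<lambda>t. p (f t))) = germ S F2 N2 K (\<lambda>t. p (f t))"
proof -
  interpret N1: filtered_module S N1 F1 by fact
  interpret N2: filtered_module S N2 F2 by fact
  have pf: "(K, \<lambda>t. p (f t)) \<in> partial_homs S F2 N2" if f: "(K, f) \<in> partial_homs S F1 N1" for K f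
    using f[unfolded N1.partial_homs_iff] F p unfolding N2.partial_homs_iff
    by (auto simp: Pi_iff right_module_map_def)
  show "(K, \<lambda>t. p (f t)) \<in> partial_homs S F2 N2" by (rule pf[OF f])
  show "(\<Union>(K, f)\<in>germ S F1 N1 K f. germ S F2 N2 K (\<lambda>t. p (f t))) = germ S F2 N2 K (\<lambda>t. p (f t))"
  proof (rule N1.UN_germ[OF f])
    fix L g C assume g: "(L, g) \<in> partial_homs S F1 N1" "C \<in> F1" "C \<subseteq> K \<inter> L"
      "\<And>t. t \<in> C \<Longrightarrow> f t = g t"
    show "germ S F2 N2 L (\<lambda>t. p (g t)) = germ S F2 N2 K (\<lambda>t. p (f t))"
      by (rule N2.germ_eqI[OF pf[OF g(1)] pf[OF f] subsetD[OF F g(2)]]) (use g in auto)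
  qed
qed

text \<open>Both composites are represented by \<open>t \<mapsto> p (e1 (f t)) - p (f (D t))\<close>
  on the same domain: \<open>p\<close> commutes with the derivations on values, and the same
  \<open>D\<close> acts on arguments over both filters.\<close>

lemma limit_map_derivation:
  assumes N1: "derivation_module S N1 F1 D e1" and N2: "derivation_module S N2 F2 D e2"
    and F: "F1 \<subseteq> F2"
    and p: "right_module_map S N1 N2 p"
    and e: "\<And>x. x \<in> carrier N1 \<Longrightarrow> p (e1 x) = e2 (p x)"
    and X: "X \<in> carrier (limit_module S F1 N1)"
  shows "derivation_module.limit_derivation S N2 F2 D e2
      (\<Union>(K, f)\<in>X. germ S F2 N2 K (\<lambda>t. p (f t))) =
    (\<Union>(K, f)\<in>derivation_module.limit_derivation S N1 F1 D e1 X. germ S F2 N2 K (\<lambda>t. p (f t)))"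
proof -
  interpret N1: derivation_module S N1 F1 D e1 by fact
  interpret N2: derivation_module S N2 F2 D e2 by fact
  interpret p: abelian_group_hom N1 N2 p
    by (rule abelian_group_homI') (use p in \<open>auto simp: right_module_map_def
      N1.N.abelian_group_axioms N2.N.abelian_group_axioms\<close>)
  obtain K f where f: "(K, f) \<in> partial_homs S F1 N1" "X = germ S F1 N1 K f"
    using X by (blast elim: N1.limit_carrierE)
  note map = limit_map_germ[OF N1.filtered_module_axioms N2.filtered_module_axioms F p]
  note df = N1.partial_homs_derivation[OF f(1)]
  note pf = map(1)[OF f(1)]
  show ?thesis
    unfolding f(2) map(2)[OF f(1)] N1.limit_derivation_germ[OF f(1)] map(2)[OF df]
      N2.limit_derivation_germ[OF pf]
  proof (rule N2.germ_eqI[OF N2.partial_homs_derivation[OF pf] map(1)[OF df]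
        N2.filter_derivation_vimage[OF N2.D N2.partial_homs_domain[OF pf]]])
    fix t assume t: "t \<in> {t \<in> K. D t \<in> K}"
    then have "f t \<in> carrier N1" "f (D t) \<in> carrier N1"
      using f(1) unfolding N1.partial_homs_iff by auto
    then show "e2 (p (f t)) \<ominus>\<^bsub>N2\<^esub> p (f (D t)) = p (e1 (f t) \<ominus>\<^bsub>N1\<^esub> f (D t))"
      by (simp add: p.hom_minus N1.e_closed e)
  qed auto
qed


section \<open>Tensor products of rings\<close>

lemma right_ideal_vimage:
  assumes "ring R" "ring T" "h \<in> ring_hom R T" "right_ideal K T"
  shows "right_ideal {r \<in> carrier R. h r \<in> K} R"
proof -
  interpret R: ring R by fact
  interpret T: ring T by fact
  interpret h: ring_hom_ring R T h by (intro ring_hom_ringI2) fact+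
  interpret K: right_ideal K T by fact
  show ?thesis
    by (rule right_idealI) (auto simp: R.ring_axioms K.I_r_closed)
qed

section \<open>Calculus of pure tensors\<close>

text \<open>Two unrelated rings keep the factors on an equal footing. With
  \<open>S = op_ring R\<close>, left ideals of \<open>R\<close> become right ideals of the second
  factor, so a single notion of filter covers both sides.\<close>

locale tensor_pair = R?: ring R + S?: ring S
  for R :: "('a, 'x) ring_scheme" (structure) and S :: "('b, 'y) ring_scheme" (structure)
begin

abbreviation T where "T \<equiv> tensor_ring R S"
abbreviation P where "P \<equiv> pair_ring R S"
abbreviation I where "I \<equiv> tensor_kernel R S"

sublocale P: ring P by (rule ring_pair_ring[OF R.ring_axioms S.ring_axioms])
sublocale I: ideal I P by (rule ideal_tensor_kernel[OF R.ring_axioms S.ring_axioms])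
sublocale T: ring T by (rule ring_tensor_ring[OF R.ring_axioms S.ring_axioms])
sublocale \<pi>: ring_hom_ring P T "(+>\<^bsub>P\<^esub>) I" unfolding tensor_ring_def by (rule I.rcos_ring_hom_ring)

lemma pair_simps [simp]: "\<zero>\<^bsub>P\<^esub> = 0" "a \<oplus>\<^bsub>P\<^esub> b = a + b"
  by (simp_all add: pair_ring_def)

lemma pair_frag_of_closed: "\<lbrakk>r \<in> carrier R; s \<in> carrier S\<rbrakk> \<Longrightarrow> frag_of (r, s) \<in> carrier P"
  by (simp add: carrier_pair_ring)

lemma pair_diff_closed: "\<lbrakk>a \<in> carrier P; b \<in> carrier P\<rbrakk> \<Longrightarrow> a - b \<in> carrier P"
  using keys_diff[of a b] by (auto simp: carrier_pair_ring)

lemma pair_add_closed: "\<lbrakk>a \<in> carrier P; b \<in> carrier P\<rbrakk> \<Longrightarrow> a + b \<in> carrier P"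
  using P.a_closed by simp

lemma tensor_ring_zero: "\<zero>\<^bsub>T\<^esub> = I"
  unfolding tensor_ring_def FactRing_def by simp

lemma coset_eqI:
  assumes "a \<in> carrier P" "b \<in> carrier P" "a - b \<in> I"
  shows "I +>\<^bsub>P\<^esub> a = I +>\<^bsub>P\<^esub> b"
proof -
  have "I +>\<^bsub>P\<^esub> a = I +>\<^bsub>P\<^esub> ((a - b) \<oplus>\<^bsub>P\<^esub> b)" by simp
  also have "\<dots> = (I +>\<^bsub>P\<^esub> (a - b)) \<oplus>\<^bsub>T\<^esub> (I +>\<^bsub>P\<^esub> b)"
    using assms by (intro \<pi>.hom_add pair_diff_closed)
  also have "I +>\<^bsub>P\<^esub> (a - b) = \<zero>\<^bsub>T\<^esub>"
    unfolding tensor_ring_zero by (rule I.a_rcos_const[OF assms(3)])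
  finally show ?thesis using assms by simp
qed

lemma coset_diff:
  assumes "a \<in> carrier P" "b \<in> carrier P"
  shows "I +>\<^bsub>P\<^esub> (a - b) = (I +>\<^bsub>P\<^esub> a) \<ominus>\<^bsub>T\<^esub> (I +>\<^bsub>P\<^esub> b)"
proof -
  have "I +>\<^bsub>P\<^esub> a = (I +>\<^bsub>P\<^esub> (a - b)) \<oplus>\<^bsub>T\<^esub> (I +>\<^bsub>P\<^esub> b)"
    using \<pi>.hom_add[OF pair_diff_closed[OF assms] assms(2)] by simp
  then show ?thesis
    using assms pair_diff_closed[OF assms]
    by (simp add: T.minus_eq T.a_assoc T.r_neg)
qed

lemma tensor_coset:
  assumes "t \<in> carrier T" obtains c where "c \<in> carrier P" "t = I +>\<^bsub>P\<^esub> c"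
  using assms unfolding tensor_ring_def FactRing_def A_RCOSETS_def' by auto

text \<open>Closure under differences takes the place of sums and negatives, so integer coefficients
  never have to be handled.\<close>

lemma pair_induct [consumes 1, case_names zero of minus]:
  assumes c: "c \<in> carrier P"
    and "Q 0" "\<And>r s. \<lbrakk>r \<in> carrier R; s \<in> carrier S\<rbrakk> \<Longrightarrow> Q (frag_of (r, s))"
    and "\<And>a b. \<lbrakk>a \<in> carrier P; b \<in> carrier P; Q a; Q b\<rbrakk> \<Longrightarrow> Q (a - b)"
  shows "Q c"
proof -
  have "c \<in> carrier P \<and> Q c"
    using c[unfolded carrier_pair_ring]
    by (induction c rule: frag_induction)
      (use assms P.zero_closed in \<open>auto simp: pair_frag_of_closed intro: pair_diff_closed\<close>)
  then show ?thesis ..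
qed

lemma tensor_induct [consumes 1, case_names zero pure minus]:
  assumes "t \<in> carrier T"
    and "Q \<zero>\<^bsub>T\<^esub>" "\<And>r s. \<lbrakk>r \<in> carrier R; s \<in> carrier S\<rbrakk> \<Longrightarrow> Q (pure_tensor R S r s)"
    and "\<And>a b. \<lbrakk>a \<in> carrier T; b \<in> carrier T; Q a; Q b\<rbrakk> \<Longrightarrow> Q (a \<ominus>\<^bsub>T\<^esub> b)"
  shows "Q t"
proof -
  obtain c where c: "c \<in> carrier P" "t = I +>\<^bsub>P\<^esub> c" using assms(1) by (rule tensor_coset)
  from c(1) have "Q (I +>\<^bsub>P\<^esub> c)"
  proof (induction c rule: pair_induct)
    case zero
    then show ?case using assms(2) \<pi>.hom_zero by simp
  next
    case (of r s)
    then show ?case using assms(3) by (simp add: pure_tensor_def)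
  next
    case (minus a b)
    then show ?case using assms(4) by (simp add: coset_diff)
  qed
  with c show ?thesis by simp
qed

lemma pure_tensor_closed [simp]:
  "\<lbrakk>r \<in> carrier R; s \<in> carrier S\<rbrakk> \<Longrightarrow> pure_tensor R S r s \<in> carrier T"
  unfolding pure_tensor_def by (intro \<pi>.hom_closed pair_frag_of_closed)

lemma pure_tensor_mult:
  assumes "r \<in> carrier R" "s \<in> carrier S" "r' \<in> carrier R" "s' \<in> carrier S"
  shows "pure_tensor R S r s \<otimes>\<^bsub>T\<^esub> pure_tensor R S r' s' = pure_tensor R S (r \<otimes> r') (s \<otimes>\<^bsub>S\<^esub> s')"
  unfolding pure_tensor_def
  by (subst \<pi>.hom_mult[symmetric]) (use assms in \<open>simp_all add: pair_frag_of_closed mult_pair_simps\<close>)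

lemma pure_tensor_one: "pure_tensor R S \<one> \<one>\<^bsub>S\<^esub> = \<one>\<^bsub>T\<^esub>"
  using \<pi>.hom_one by (simp add: pure_tensor_def pair_ring_def)

lemma tensor_kernel_relation: "h \<in> tensor_relations R S \<Longrightarrow> h \<in> I"
  unfolding tensor_kernel_def by (rule generate.incl)

lemma pure_tensor_add_left:
  assumes "r \<in> carrier R" "r' \<in> carrier R" "s \<in> carrier S"
  shows "pure_tensor R S (r \<oplus> r') s = pure_tensor R S r s \<oplus>\<^bsub>T\<^esub> pure_tensor R S r' s"
proof -
  have "frag_of (r \<oplus> r', s) - frag_of (r, s) - frag_of (r', s) \<in> I"
    using assms by (intro tensor_kernel_relation) (auto simp: tensor_relations_def)
  then have "I +>\<^bsub>P\<^esub> frag_of (r \<oplus> r', s) = I +>\<^bsub>P\<^esub> (frag_of (r, s) + frag_of (r', s))"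
    using assms by (intro coset_eqI pair_add_closed) (simp_all add: pair_frag_of_closed diff_diff_eq)
  then show ?thesis
    using \<pi>.hom_add[of "frag_of (r, s)" "frag_of (r', s)"] assms
    by (simp add: pure_tensor_def pair_frag_of_closed)
qed

lemma pure_tensor_add_right:
  assumes "r \<in> carrier R" "s \<in> carrier S" "s' \<in> carrier S"
  shows "pure_tensor R S r (s \<oplus>\<^bsub>S\<^esub> s') = pure_tensor R S r s \<oplus>\<^bsub>T\<^esub> pure_tensor R S r s'"
proof -
  have "frag_of (r, s \<oplus>\<^bsub>S\<^esub> s') - frag_of (r, s) - frag_of (r, s') \<in> I"
    using assms by (intro tensor_kernel_relation) (auto simp: tensor_relations_def)
  then have "I +>\<^bsub>P\<^esub> frag_of (r, s \<oplus>\<^bsub>S\<^esub> s') = I +>\<^bsub>P\<^esub> (frag_of (r, s) + frag_of (r, s'))"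
    using assms by (intro coset_eqI pair_add_closed) (simp_all add: pair_frag_of_closed diff_diff_eq)
  then show ?thesis
    using \<pi>.hom_add[of "frag_of (r, s)" "frag_of (r, s')"] assms
    by (simp add: pure_tensor_def pair_frag_of_closed)
qed

lemma pure_tensor_left_hom: "(\<lambda>r. pure_tensor R S r \<one>\<^bsub>S\<^esub>) \<in> ring_hom R T"
  by (rule ring_hom_memI) (simp_all add: pure_tensor_mult pure_tensor_add_left pure_tensor_one)

lemma pure_tensor_right_hom: "(\<lambda>s. pure_tensor R S \<one> s) \<in> ring_hom S T"
  by (rule ring_hom_memI) (simp_all add: pure_tensor_mult pure_tensor_add_right pure_tensor_one)

section \<open>Gabriel filters on a tensor product\<close>

definition filter_product :: "'a set set \<Rightarrow> 'b set set \<Rightarrow> ('a \<times> 'b \<Rightarrow>\<^sub>0 int) set set set"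
  where "filter_product F G = {K. right_ideal K T \<and>
    {r \<in> carrier R. pure_tensor R S r \<one>\<^bsub>S\<^esub> \<in> K} \<in> F \<and> {s \<in> carrier S. pure_tensor R S \<one> s \<in> K} \<in> G}"

lemma right_ideal_residual:
  assumes "right_ideal K T" "t \<in> carrier T"
  shows "right_ideal (residual T K t) T"
proof -
  interpret K: right_ideal K T by fact
  show ?thesis
    by (rule right_idealI)
      (use assms in \<open>auto simp: residual_def T.ring_axioms T.r_distr K.I_r_closed simp flip: T.m_assoc\<close>)
qed

text \<open>The two factors commute in the tensor product: \<open>r \<otimes> s\<close> is
  \<open>(r \<otimes> 1)(1 \<otimes> s)\<close> and also
  \<open>(1 \<otimes> s)(r \<otimes> 1)\<close>, so a right ideal containing either first factor
  contains it.\<close>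

lemma pure_tensor_in_right_ideal:
  assumes "right_ideal K T" "r \<in> carrier R" "s \<in> carrier S"
  shows "pure_tensor R S r \<one>\<^bsub>S\<^esub> \<in> K \<Longrightarrow> pure_tensor R S r s \<in> K"
    and "pure_tensor R S \<one> s \<in> K \<Longrightarrow> pure_tensor R S r s \<in> K"
  using right_ideal.I_r_closed[OF assms(1), of "pure_tensor R S r \<one>\<^bsub>S\<^esub>" "pure_tensor R S \<one> s"]
    right_ideal.I_r_closed[OF assms(1), of "pure_tensor R S \<one> s" "pure_tensor R S r \<one>\<^bsub>S\<^esub>"] assms
  by (simp_all add: pure_tensor_mult)

text \<open>Stated for a general \<open>h\<close> to serve both embeddings of the factors. The
  assumption on pure tensors says that the preimage of \<open>(K : r \<otimes> s)\<close> contains a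
  residual, at \<open>c\<close>, of the preimage of \<open>K\<close>. A general \<open>t\<close> is
  reached by differences, since \<open>(K : a - b)\<close> contains
  \<open>(K : a) \<inter> (K : b)\<close>.\<close>

lemma residual_vimage_in_filter:
  assumes h: "h \<in> ring_hom A T" "ring A" and F: "right_gabriel_filter A F"
    and K: "right_ideal K T" "{a \<in> carrier A. h a \<in> K} \<in> F"
    and pure: "\<And>r s. \<lbrakk>r \<in> carrier R; s \<in> carrier S\<rbrakk> \<Longrightarrow> \<exists>c\<in>carrier A. \<forall>a\<in>carrier A.
      h (c \<otimes>\<^bsub>A\<^esub> a) \<in> K \<longrightarrow> pure_tensor R S r s \<otimes>\<^bsub>T\<^esub> h a \<in> K"
    and t: "t \<in> carrier T"
  shows "{a \<in> carrier A. h a \<in> residual T K t} \<in> F"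
proof -
  interpret K: right_ideal K T by fact
  interpret F: gabriel_filter A F by (intro gabriel_filter.intro gabriel_filter_axioms.intro h F)
  interpret h: ring_hom_ring A T h
    by (intro ring_hom_ringI2 h T.ring_axioms)
  have ri: "right_ideal {a \<in> carrier A. h a \<in> residual T K t} A" if "t \<in> carrier T" for t
    by (rule right_ideal_vimage[OF h(2) T.ring_axioms h(1) right_ideal_residual[OF K(1) that]])
  from t show ?thesis
  proof (induction t rule: tensor_induct)
    case zero
    have "carrier A \<subseteq> {a \<in> carrier A. h a \<in> residual T K \<zero>\<^bsub>T\<^esub>}"
      by (auto simp: residual_def)
    then show ?case by (rule F.filter_up[OF F.filter_carrier ri[OF T.zero_closed]])
  next
    case (pure r s)
    then obtain c where c: "c \<in> carrier A" "\<forall>a\<in>carrier A.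
      h (c \<otimes>\<^bsub>A\<^esub> a) \<in> K \<longrightarrow> pure_tensor R S r s \<otimes>\<^bsub>T\<^esub> h a \<in> K" using assms(6) by blast
    show ?case
      by (rule F.filter_up[OF F.filter_residual[OF K(2) c(1)] ri])
        (use c pure in \<open>auto simp: residual_def\<close>)
  next
    case (minus a b)
    then show ?case
      by (intro F.filter_up[OF F.filter_Int[OF minus(3,4)] ri])
        (use minus(1,2) in \<open>auto simp: residual_def T.minus_eq T.l_distr T.l_minus\<close>)
  qed
qed

lemma filter_product_gabriel:
  assumes F: "right_gabriel_filter R F" and G: "right_gabriel_filter S G"
  shows "right_gabriel_filter T (filter_product F G)"
proof -
  interpret F: gabriel_filter R F
    by (intro gabriel_filter.intro gabriel_filter_axioms.intro R.ring_axioms F)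
  interpret G: gabriel_filter S G
    by (intro gabriel_filter.intro gabriel_filter_axioms.intro S.ring_axioms G)
  let ?A = "\<lambda>K. {r \<in> carrier R. pure_tensor R S r \<one>\<^bsub>S\<^esub> \<in> K}"
  let ?B = "\<lambda>K. {s \<in> carrier S. pure_tensor R S \<one> s \<in> K}"
  have mem: "K \<in> filter_product F G \<longleftrightarrow> right_ideal K T \<and> ?A K \<in> F \<and> ?B K \<in> G" for K
    by (simp add: filter_product_def)
  have A: "right_ideal (?A K) R" and B: "right_ideal (?B K) S" if "right_ideal K T" for K
    using right_ideal_vimage[OF R.ring_axioms T.ring_axioms pure_tensor_left_hom that]
      right_ideal_vimage[OF S.ring_axioms T.ring_axioms pure_tensor_right_hom that] .
  have car: "right_ideal (carrier T) T"
    by (rule right_idealI) (auto simp: T.ring_axioms)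
  have resA: "?A (residual T K t) \<in> F" if K: "K \<in> filter_product F G" and t: "t \<in> carrier T" for K t
  proof -
    have K: "right_ideal K T" "?A K \<in> F" using K by (simp_all add: mem)
    show ?thesis
    proof (rule residual_vimage_in_filter[OF pure_tensor_left_hom R.ring_axioms F K _ t])
      fix r s assume rs: "r \<in> carrier R" "s \<in> carrier S"
      \<comment> \<open>The witness is \<open>r\<close>, because \<open>(r \<otimes> s)(a \<otimes>
        1) = (r a \<otimes> 1)(1 \<otimes> s)\<close>. For the other factor the roles are exchanged
        and the witness is \<open>s\<close>.\<close>
      then show "\<exists>c\<in>carrier R. \<forall>a\<in>carrier R. pure_tensor R S (c \<otimes> a) \<one>\<^bsub>S\<^esub> \<in> K \<longrightarrow>
        pure_tensor R S r s \<otimes>\<^bsub>T\<^esub> pure_tensor R S a \<one>\<^bsub>S\<^esub> \<in> K"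
        by (intro bexI[of _ r]) (auto simp: pure_tensor_mult pure_tensor_in_right_ideal(1)[OF K(1)])
    qed
  qed
  have resB: "?B (residual T K t) \<in> G" if K: "K \<in> filter_product F G" and t: "t \<in> carrier T" for K t
  proof -
    have K: "right_ideal K T" "?B K \<in> G" using K by (simp_all add: mem)
    show ?thesis
    proof (rule residual_vimage_in_filter[OF pure_tensor_right_hom S.ring_axioms G K _ t])
      fix r s assume rs: "r \<in> carrier R" "s \<in> carrier S"
      then show "\<exists>c\<in>carrier S. \<forall>a\<in>carrier S. pure_tensor R S \<one> (c \<otimes>\<^bsub>S\<^esub> a) \<in> K \<longrightarrow>
        pure_tensor R S r s \<otimes>\<^bsub>T\<^esub> pure_tensor R S \<one> a \<in> K"
        by (intro bexI[of _ s]) (auto simp: pure_tensor_mult pure_tensor_in_right_ideal(2)[OF K(1)])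
    qed
  qed
  show ?thesis
    unfolding right_gabriel_filter_def
  proof (intro conjI ballI allI impI)
    have "?A (carrier T) = carrier R" "?B (carrier T) = carrier S" by auto
    then have "carrier T \<in> filter_product F G"
      by (simp only: mem car F.filter_carrier G.filter_carrier)
    then show "filter_product F G \<noteq> {}" by blast
  next
    fix K assume "K \<in> filter_product F G"
    then show "right_ideal K T" by (simp add: mem)
  next
    fix K L assume K: "K \<in> filter_product F G" and L: "right_ideal L T \<and> K \<subseteq> L"
    then have "?A K \<subseteq> ?A L" "?B K \<subseteq> ?B L" by auto
    with K L show "L \<in> filter_product F G"
      unfolding mem using F.filter_up[OF _ A] G.filter_up[OF _ B] by blast
  next
    fix K L assume KL: "K \<in> filter_product F G" "L \<in> filter_product F G"
    interpret K: right_ideal K T using KL by (simp add: mem)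
    interpret L: right_ideal L T using KL by (simp add: mem)
    have "right_ideal (K \<inter> L) T"
      by (rule right_idealI) (auto simp: T.ring_axioms K.I_r_closed L.I_r_closed)
    moreover have "?A (K \<inter> L) = ?A K \<inter> ?A L" "?B (K \<inter> L) = ?B K \<inter> ?B L" by auto
    ultimately show "K \<inter> L \<in> filter_product F G"
      using KL F.filter_Int G.filter_Int by (simp only: mem)
  next
    fix K t assume "K \<in> filter_product F G" "t \<in> carrier T"
    then show "residual T K t \<in> filter_product F G"
      using resA resB right_ideal_residual by (simp add: mem)
  next
    fix K L
    assume KL: "right_ideal K T \<and> L \<in> filter_product F G \<and> (\<forall>t\<in>L. residual T K t \<in> filter_product F G)"
    have "?A K \<in> F"
    proof (rule F.filter_trans)
      show "right_ideal (?A K) R" "?A L \<in> F" using KL A by (auto simp: mem)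
      fix r assume r: "r \<in> ?A L"
      \<comment> \<open>Residuals commute with preimages along
        \<open>r \<mapsto> r \<otimes> 1\<close>. This turns the hypothesis on
        \<open>residual T K\<close> at elements of \<open>L\<close> into the transitivity condition
        for \<open>F\<close>.\<close>
      have "residual R (?A K) r = ?A (residual T K (pure_tensor R S r \<one>\<^bsub>S\<^esub>))"
        using r by (auto simp: residual_def pure_tensor_mult)
      then show "residual R (?A K) r \<in> F" using r KL by (simp add: mem)
    qed
    moreover have "?B K \<in> G"
    proof (rule G.filter_trans)
      show "right_ideal (?B K) S" "?B L \<in> G" using KL B by (auto simp: mem)
      fix s assume s: "s \<in> ?B L"
      have "residual S (?B K) s = ?B (residual T K (pure_tensor R S \<one> s))"
        using s by (auto simp: residual_def pure_tensor_mult)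
      then show "residual S (?B K) s \<in> G" using s KL by (simp add: mem)
    qed
    ultimately show "K \<in> filter_product F G" using KL by (simp add: mem)
  qed
qed

section \<open>Derivations of a tensor product\<close>

definition pair_derivation :: "('a \<Rightarrow> 'a) \<Rightarrow> ('b \<Rightarrow> 'b) \<Rightarrow> ('a \<times> 'b \<Rightarrow>\<^sub>0 int) \<Rightarrow> ('a \<times> 'b \<Rightarrow>\<^sub>0 int)"
  where "pair_derivation \<delta> \<epsilon> = frag_extend (\<lambda>(r, s). frag_of (\<delta> r, s) + frag_of (r, \<epsilon> s))"

definition tensor_derivation ::
    "('a \<Rightarrow> 'a) \<Rightarrow> ('b \<Rightarrow> 'b) \<Rightarrow> ('a \<times> 'b \<Rightarrow>\<^sub>0 int) set \<Rightarrow> ('a \<times> 'b \<Rightarrow>\<^sub>0 int) set"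
  where "tensor_derivation \<delta> \<epsilon> t = (\<Union>c\<in>t. I +>\<^bsub>P\<^esub> pair_derivation \<delta> \<epsilon> c)"

lemma pair_derivation_simps:
  "pair_derivation \<delta> \<epsilon> 0 = 0"
  "pair_derivation \<delta> \<epsilon> (a + b) = pair_derivation \<delta> \<epsilon> a + pair_derivation \<delta> \<epsilon> b"
  "pair_derivation \<delta> \<epsilon> (a - b) = pair_derivation \<delta> \<epsilon> a - pair_derivation \<delta> \<epsilon> b"
  "pair_derivation \<delta> \<epsilon> (frag_of (r, s)) = frag_of (\<delta> r, s) + frag_of (r, \<epsilon> s)"
  by (simp_all add: pair_derivation_def frag_extend_add frag_extend_diff)

context
  fixes \<delta> \<epsilon>
  assumes \<delta>: "ring_derivation R \<delta>" and \<epsilon>: "ring_derivation S \<epsilon>"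
begin

interpretation \<delta>: abelian_group_hom R R \<delta> by (rule R.ring_derivation_hom[OF \<delta>])
interpretation \<epsilon>: abelian_group_hom S S \<epsilon> by (rule S.ring_derivation_hom[OF \<epsilon>])

lemma pair_derivation_closed:
  assumes "c \<in> carrier P" shows "pair_derivation \<delta> \<epsilon> c \<in> carrier P"
  using assms
proof (induction c rule: pair_induct)
  case zero
  show ?case using P.zero_closed by (simp add: pair_derivation_simps)
qed (auto simp: pair_derivation_simps pair_frag_of_closed intro: pair_add_closed pair_diff_closed)

lemma kernel_add: "\<lbrakk>a \<in> I; b \<in> I\<rbrakk> \<Longrightarrow> a + b \<in> I"
  using I.a_closed[of a b] by simp

lemma kernel_uminus: assumes a: "a \<in> I" shows "- a \<in> I"
proof -
  have "\<ominus>\<^bsub>P\<^esub> a = - a"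
    using I.a_Hcarr[OF a] by (intro P.minus_equality) (simp_all add: carrier_pair_ring)
  with I.a_inv_closed[OF a] show ?thesis by simp
qed

lemma kernel_diff: "\<lbrakk>a \<in> I; b \<in> I\<rbrakk> \<Longrightarrow> a - b \<in> I"
  using kernel_add[OF _ kernel_uminus, of a b] by simp

lemma kernel_left:
  "\<lbrakk>r \<in> carrier R; r' \<in> carrier R; s \<in> carrier S\<rbrakk> \<Longrightarrow>
    frag_of (r \<oplus> r', s) - frag_of (r, s) - frag_of (r', s) \<in> I"
  and kernel_right:
  "\<lbrakk>r \<in> carrier R; s \<in> carrier S; s' \<in> carrier S\<rbrakk> \<Longrightarrow>
    frag_of (r, s \<oplus>\<^bsub>S\<^esub> s') - frag_of (r, s) - frag_of (r, s') \<in> I"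
  by (rule tensor_kernel_relation, unfold tensor_relations_def, blast)+

text \<open>A biadditivity relation is sent to the sum of two relations of the same kind: one with
  \<open>\<delta>\<close> applied throughout the first slot, one with \<open>\<epsilon>\<close>
  applied throughout the second.\<close>

lemma pair_derivation_relation:
  assumes "h \<in> tensor_relations R S" shows "pair_derivation \<delta> \<epsilon> h \<in> I"
  using assms unfolding tensor_relations_def
proof (elim UnE CollectE exE conjE)
  fix r r' s assume h: "h = frag_of (r \<oplus> r', s) - frag_of (r, s) - frag_of (r', s)"
    and rs: "r \<in> carrier R" "r' \<in> carrier R" "s \<in> carrier S"
  have "pair_derivation \<delta> \<epsilon> h =
    (frag_of (\<delta> r \<oplus> \<delta> r', s) - frag_of (\<delta> r, s) - frag_of (\<delta> r', s)) +
    (frag_of (r \<oplus> r', \<epsilon> s) - frag_of (r, \<epsilon> s) - frag_of (r', \<epsilon> s))"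
    using rs by (simp add: h pair_derivation_simps)
  also have "\<dots> \<in> I"
    using rs by (intro kernel_add kernel_left) simp_all
  finally show ?thesis .
next
  fix r s s' assume h: "h = frag_of (r, s \<oplus>\<^bsub>S\<^esub> s') - frag_of (r, s) - frag_of (r, s')"
    and rs: "r \<in> carrier R" "s \<in> carrier S" "s' \<in> carrier S"
  have "pair_derivation \<delta> \<epsilon> h =
    (frag_of (\<delta> r, s \<oplus>\<^bsub>S\<^esub> s') - frag_of (\<delta> r, s) - frag_of (\<delta> r, s')) +
    (frag_of (r, \<epsilon> s \<oplus>\<^bsub>S\<^esub> \<epsilon> s') - frag_of (r, \<epsilon> s) - frag_of (r, \<epsilon> s'))"
    using rs by (simp add: h pair_derivation_simps)
  also have "\<dots> \<in> I"
    using rs by (intro kernel_add kernel_right) simp_all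
  finally show ?thesis .
qed

lemma pair_derivation_kernel: "c \<in> I \<Longrightarrow> pair_derivation \<delta> \<epsilon> c \<in> I"
proof (induction c rule: generate.induct[of _ "free_Abelian_group (carrier R \<times> carrier S)"
      "tensor_relations R S", folded tensor_kernel_def, consumes 1, case_names one incl inv eng])
  case one
  show ?case using I.zero_closed by (simp add: pair_derivation_simps)
next
  case (inv h)
  have "Poly_Mapping.keys h \<subseteq> carrier R \<times> carrier S"
    using I.a_Hcarr[OF tensor_kernel_relation[OF inv]] by (simp add: carrier_pair_ring)
  then have "inv\<^bsub>free_Abelian_group (carrier R \<times> carrier S)\<^esub> h = - h" by simp
  moreover have "pair_derivation \<delta> \<epsilon> (- h) = - pair_derivation \<delta> \<epsilon> h"
    using pair_derivation_simps(3)[of \<delta> \<epsilon> 0 h] by (simp add: pair_derivation_simps)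
  ultimately show ?case by (simp add: kernel_uminus pair_derivation_relation inv)
qed (simp_all add: pair_derivation_relation pair_derivation_simps kernel_add)

text \<open>The free group is not additive in either slot, so the product rule holds there only
  modulo the kernel. On generators the defect is one relation splitting
  \<open>\<delta> (r \<otimes> r')\<close> plus one splitting
  \<open>\<epsilon> (s \<otimes> s')\<close>.\<close>

lemma pair_derivation_mult:
  assumes a: "a \<in> carrier P" and b: "b \<in> carrier P"
  shows "pair_derivation \<delta> \<epsilon> (a \<otimes>\<^bsub>P\<^esub> b) -
    (pair_derivation \<delta> \<epsilon> a \<otimes>\<^bsub>P\<^esub> b + a \<otimes>\<^bsub>P\<^esub> pair_derivation \<delta> \<epsilon> b) \<in> I"
  using a
proof (induction a rule: pair_induct)
  case zero
  show ?case using I.zero_closed by (simp add: pair_derivation_simps mult_pair_simps)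
next
  case (of r s)
  show ?case using b
  proof (induction b rule: pair_induct)
    case zero
    show ?case using I.zero_closed by (simp add: pair_derivation_simps mult_pair_simps)
  next
    case (of r' s')
    have "\<delta> (r \<otimes> r') = \<delta> r \<otimes> r' \<oplus> r \<otimes> \<delta> r'" "\<epsilon> (s \<otimes>\<^bsub>S\<^esub> s') = \<epsilon> s \<otimes>\<^bsub>S\<^esub> s' \<oplus>\<^bsub>S\<^esub> s \<otimes>\<^bsub>S\<^esub> \<epsilon> s'"
      using \<delta> \<epsilon> of \<open>r \<in> carrier R\<close> \<open>s \<in> carrier S\<close> by (simp_all add: ring_derivation_def)
    moreover have "(frag_of (\<delta> r \<otimes> r' \<oplus> r \<otimes> \<delta> r', s \<otimes>\<^bsub>S\<^esub> s') - frag_of (\<delta> r \<otimes> r', s \<otimes>\<^bsub>S\<^esub> s') -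
          frag_of (r \<otimes> \<delta> r', s \<otimes>\<^bsub>S\<^esub> s')) +
        (frag_of (r \<otimes> r', \<epsilon> s \<otimes>\<^bsub>S\<^esub> s' \<oplus>\<^bsub>S\<^esub> s \<otimes>\<^bsub>S\<^esub> \<epsilon> s') - frag_of (r \<otimes> r', \<epsilon> s \<otimes>\<^bsub>S\<^esub> s') -
          frag_of (r \<otimes> r', s \<otimes>\<^bsub>S\<^esub> \<epsilon> s')) \<in> I"
      using of \<open>r \<in> carrier R\<close> \<open>s \<in> carrier S\<close> by (intro kernel_add kernel_left kernel_right) simp_all
    ultimately show ?case by (simp add: pair_derivation_simps mult_pair_simps algebra_simps)
  next
    case (minus a b)
    from kernel_diff[OF minus(3,4)] show ?case
      by (simp add: pair_derivation_simps mult_pair_simps algebra_simps)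
  qed
next
  case (minus a b)
  from kernel_diff[OF minus(3,4)] show ?case
    by (simp add: pair_derivation_simps mult_pair_simps algebra_simps)
qed

lemma tensor_derivation_coset:
  assumes "c \<in> carrier P"
  shows "tensor_derivation \<delta> \<epsilon> (I +>\<^bsub>P\<^esub> c) = I +>\<^bsub>P\<^esub> pair_derivation \<delta> \<epsilon> c"
  unfolding tensor_derivation_def
proof (rule coset_map_apply)
  show "abelian_group_hom P P (pair_derivation \<delta> \<epsilon>)"
    by (rule abelian_group_homI')
      (simp_all add: P.abelian_group_axioms pair_derivation_closed pair_derivation_simps)
qed (use assms pair_derivation_kernel I.additive_subgroup_axioms in auto)

lemma tensor_derivation_pure:
  assumes "r \<in> carrier R" "s \<in> carrier S"
  shows "tensor_derivation \<delta> \<epsilon> (pure_tensor R S r s) =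
    pure_tensor R S (\<delta> r) s \<oplus>\<^bsub>T\<^esub> pure_tensor R S r (\<epsilon> s)"
  using assms \<pi>.hom_add[of "frag_of (\<delta> r, s)" "frag_of (r, \<epsilon> s)"]
  by (simp add: pure_tensor_def tensor_derivation_coset pair_frag_of_closed pair_derivation_simps)

lemma ring_derivation_tensor: "ring_derivation T (tensor_derivation \<delta> \<epsilon>)"
  unfolding ring_derivation_def
proof (intro conjI ballI funcsetI)
  fix t assume "t \<in> carrier T"
  then obtain a where a: "a \<in> carrier P" "t = I +>\<^bsub>P\<^esub> a" by (rule tensor_coset)
  show "tensor_derivation \<delta> \<epsilon> t \<in> carrier T"
    unfolding a(2) tensor_derivation_coset[OF a(1)]
    by (intro \<pi>.hom_closed pair_derivation_closed a)
  fix u assume "u \<in> carrier T"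
  then obtain b where b: "b \<in> carrier P" "u = I +>\<^bsub>P\<^esub> b" by (rule tensor_coset)
  note c = a(1) b(1) pair_derivation_closed[OF a(1)] pair_derivation_closed[OF b(1)]
  have s: "a \<oplus>\<^bsub>P\<^esub> b \<in> carrier P" "a \<otimes>\<^bsub>P\<^esub> b \<in> carrier P" using a b by (intro P.a_closed P.m_closed; simp)+
  show "tensor_derivation \<delta> \<epsilon> (t \<oplus>\<^bsub>T\<^esub> u) = tensor_derivation \<delta> \<epsilon> t \<oplus>\<^bsub>T\<^esub> tensor_derivation \<delta> \<epsilon> u"
    unfolding a(2) b(2) tensor_derivation_coset[OF a(1)] tensor_derivation_coset[OF b(1)]
      \<pi>.hom_add[OF a(1) b(1), symmetric] tensor_derivation_coset[OF s(1)]
      \<pi>.hom_add[OF c(3,4), symmetric]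
    by (simp add: pair_derivation_simps)
  have "I +>\<^bsub>P\<^esub> pair_derivation \<delta> \<epsilon> (a \<otimes>\<^bsub>P\<^esub> b) =
    I +>\<^bsub>P\<^esub> (pair_derivation \<delta> \<epsilon> a \<otimes>\<^bsub>P\<^esub> b \<oplus>\<^bsub>P\<^esub> a \<otimes>\<^bsub>P\<^esub> pair_derivation \<delta> \<epsilon> b)"
    by (rule coset_eqI)
      (use pair_derivation_mult[OF a(1) b(1)] pair_derivation_closed[OF s(2)] c in
        \<open>simp_all add: pair_add_closed\<close>)
  also have "\<dots> = (I +>\<^bsub>P\<^esub> pair_derivation \<delta> \<epsilon> a) \<otimes>\<^bsub>T\<^esub> (I +>\<^bsub>P\<^esub> b) \<oplus>\<^bsub>T\<^esub>
      (I +>\<^bsub>P\<^esub> a) \<otimes>\<^bsub>T\<^esub> (I +>\<^bsub>P\<^esub> pair_derivation \<delta> \<epsilon> b)"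
    using c by (simp only: \<pi>.hom_add \<pi>.hom_mult P.m_closed)
  finally show "tensor_derivation \<delta> \<epsilon> (t \<otimes>\<^bsub>T\<^esub> u) =
      tensor_derivation \<delta> \<epsilon> t \<otimes>\<^bsub>T\<^esub> u \<oplus>\<^bsub>T\<^esub> t \<otimes>\<^bsub>T\<^esub> tensor_derivation \<delta> \<epsilon> u"
    unfolding a(2) b(2) tensor_derivation_coset[OF a(1)] tensor_derivation_coset[OF b(1)]
      \<pi>.hom_mult[OF a(1) b(1), symmetric] tensor_derivation_coset[OF s(2)] .
qed

end

end


section \<open>Bimodules over the enveloping ring\<close>

locale enveloping_ring = env: tensor_pair R "op_ring R"
  for R :: "('a, 'x) ring_scheme" (structure)
begin

section \<open>Symmetric filters as Gabriel filters on the enveloping ring\<close>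

lemma induced_symmetric_filter_eq:
  assumes Fl: "left_gabriel_filter R Fl" and Fr: "right_gabriel_filter R Fr"
  shows "induced_symmetric_filter R Fl Fr = env.filter_product Fr Fl"
proof -
  interpret Fl: gabriel_filter "op_ring R" Fl
    using Fl by (intro gabriel_filter.intro gabriel_filter_axioms.intro env.S.ring_axioms)
      (simp add: left_gabriel_filter_def)
  interpret Fr: gabriel_filter R Fr
    using Fr by (intro gabriel_filter.intro gabriel_filter_axioms.intro env.R.ring_axioms)
  have "(\<exists>I\<in>Fl. \<exists>J\<in>Fr. tensor_image R (op_ring R) J (carrier R)
         <+>\<^bsub>env_ring R\<^esub> tensor_image R (op_ring R) (carrier R) I \<subseteq> K) \<longleftrightarrow>
      {r \<in> carrier R. env_tensor R r \<one> \<in> K} \<in> Fr \<and> {s \<in> carrier R. env_tensor R \<one> s \<in> K} \<in> Fl"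
    if K: "right_ideal K (env_ring R)" for K
  proof -
    interpret K: right_ideal K "env_ring R" by fact
    let ?A = "{r \<in> carrier R. env_tensor R r \<one> \<in> K}" and ?B = "{s \<in> carrier R. env_tensor R \<one> s \<in> K}"
    have A: "right_ideal ?A R"
      using right_ideal_vimage[OF env.R.ring_axioms env.T.ring_axioms env.pure_tensor_left_hom K] by simp
    have B: "right_ideal ?B (op_ring R)"
      using right_ideal_vimage[OF env.S.ring_axioms env.T.ring_axioms env.pure_tensor_right_hom K] by simp
    show ?thesis
    proof
      assume "\<exists>I\<in>Fl. \<exists>J\<in>Fr. tensor_image R (op_ring R) J (carrier R)
         <+>\<^bsub>env_ring R\<^esub> tensor_image R (op_ring R) (carrier R) I \<subseteq> K"
      then obtain I J where IJ: "I \<in> Fl" "J \<in> Fr" "tensor_image R (op_ring R) J (carrier R)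
         <+>\<^bsub>env_ring R\<^esub> tensor_image R (op_ring R) (carrier R) I \<subseteq> K" by blast
      \<comment> \<open>Taking zero in one summand shows that \<open>K\<close> contains each tensor
        image separately, hence \<open>j \<otimes> 1\<close> and \<open>1 \<otimes> i\<close>. The
        preimages of \<open>K\<close> therefore contain \<open>J\<close> and
        \<open>I\<close>.\<close>
      have zero: "\<zero>\<^bsub>env_ring R\<^esub> \<in> tensor_image R (op_ring R) C C'" for C C'
        using generate.one[of "add_monoid (env_ring R)"] by (simp add: tensor_image_def)
      have sub: "J \<subseteq> carrier R" "I \<subseteq> carrier R"
        using Fr.filter_subset[OF IJ(2)] Fl.filter_subset[OF IJ(1)] by simp_all
      have sum: "x \<oplus>\<^bsub>env_ring R\<^esub> y \<in> K" if "x \<in> tensor_image R (op_ring R) J (carrier R)"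
        "y \<in> tensor_image R (op_ring R) (carrier R) I" for x y
        using that IJ(3) by (auto simp: set_add_def')
      have gen: "env_tensor R r s \<in> tensor_image R (op_ring R) C C'" if "r \<in> C" "s \<in> C'" for r s C C'
        using that unfolding tensor_image_def by (intro generate.incl) blast
      have "J \<subseteq> ?A"
      proof
        fix j assume j: "j \<in> J"
        from sum[OF gen[OF j env.R.one_closed] zero] show "j \<in> ?A" using j sub by auto
      qed
      moreover have "I \<subseteq> ?B"
      proof
        fix i assume i: "i \<in> I"
        from sum[OF zero gen[OF env.R.one_closed i]] show "i \<in> ?B" using i sub by auto
      qed
      ultimately show "?A \<in> Fr \<and> ?B \<in> Fl"
        using Fr.filter_up[OF IJ(2) A] Fl.filter_up[OF IJ(1) B] by blast
    next
      \<comment> \<open>For the converse the preimages themselves serve as the two ideals: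
        \<open>K\<close> contains \<open>r \<otimes> s\<close> as soon as it contains
        \<open>r \<otimes> 1\<close> or \<open>1 \<otimes> s\<close>.\<close>
      assume AB: "?A \<in> Fr \<and> ?B \<in> Fl"
      have sub: "tensor_image R (op_ring R) C C' \<subseteq> K"
        if "\<And>r s. \<lbrakk>r \<in> C; s \<in> C'\<rbrakk> \<Longrightarrow> env_tensor R r s \<in> K" for C C'
        unfolding tensor_image_def
        by (rule env.T.add.generate_subgroup_incl[OF _ K.a_subgroup]) (use that in auto)
      have "tensor_image R (op_ring R) ?A (carrier R) \<subseteq> K"
        by (rule sub) (use env.pure_tensor_in_right_ideal(1)[OF K] in auto)
      moreover have "tensor_image R (op_ring R) (carrier R) ?B \<subseteq> K"
        by (rule sub) (use env.pure_tensor_in_right_ideal(2)[OF K] in auto)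
      ultimately have "tensor_image R (op_ring R) ?A (carrier R)
         <+>\<^bsub>env_ring R\<^esub> tensor_image R (op_ring R) (carrier R) ?B \<subseteq> K"
        by (auto simp: set_add_def' intro!: K.a_closed)
      with AB show "\<exists>I\<in>Fl. \<exists>J\<in>Fr. tensor_image R (op_ring R) J (carrier R)
         <+>\<^bsub>env_ring R\<^esub> tensor_image R (op_ring R) (carrier R) I \<subseteq> K" by blast
    qed
  qed
  then show ?thesis
    by (auto simp: induced_symmetric_filter_def env.filter_product_def)
qed

lemma symmetric_filter_gabriel:
  assumes "symmetric_filter R F" shows "gabriel_filter (env_ring R) F"
proof -
  obtain Fl Fr where F: "left_gabriel_filter R Fl" "right_gabriel_filter R Fr"
    "F = env.filter_product Fr Fl"
    using assms induced_symmetric_filter_eq by (auto simp: symmetric_filter_def)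
  have "right_gabriel_filter (env_ring R) F"
    unfolding F(3) using F(1,2) by (intro env.filter_product_gabriel) (simp_all add: left_gabriel_filter_def)
  then show ?thesis
    by (intro gabriel_filter.intro gabriel_filter_axioms.intro env.T.ring_axioms)
qed

lemma ring_derivation_op_ring: "ring_derivation R \<delta> \<Longrightarrow> ring_derivation (op_ring R) \<delta>"
  by (auto simp: ring_derivation_def Pi_iff env.R.a_comm)

end

section \<open>Bimodules as right modules over the enveloping ring\<close>

context bimodule
begin

sublocale E: enveloping_ring R
  by (intro enveloping_ring.intro tensor_pair.intro ring_op_ring R.ring_axioms)

lemma env_carrierD: "c \<in> carrier E.env.P \<Longrightarrow> Poly_Mapping.keys c \<subseteq> carrier R \<times> carrier R"
  by (simp add: carrier_pair_ring)

lemma formal_smult_zero: "formal_smult M 0 x = \<zero>\<^bsub>M\<^esub>"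
  by (simp add: formal_smult_def)

lemma formal_smult_r_distr:
  assumes "c \<in> carrier E.env.P" "x \<in> carrier M" "y \<in> carrier M"
  shows "formal_smult M c (x \<oplus>\<^bsub>M\<^esub> y) = formal_smult M c x \<oplus>\<^bsub>M\<^esub> formal_smult M c y"
  using assms(1)
proof (induction c rule: E.env.pair_induct)
  case zero
  show ?case by (simp add: formal_smult_zero)
next
  case (of r s)
  then show ?case
    using assms by (simp add: formal_smult_frag_of lsmult_r_distr rsmult_l_distr rsmult_closed)
next
  case (minus a b)
  then show ?case
    using assms by (simp add: formal_smult_diff env_carrierD formal_smult_closed M.minus_add_minus)
qed

lemma formal_smult_hom: "c \<in> carrier E.env.P \<Longrightarrow> abelian_group_hom M M (formal_smult M c)"
  by (rule abelian_group_homI')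
    (auto simp: M.abelian_group_axioms formal_smult_closed env_carrierD formal_smult_r_distr)

text \<open>On generators both sides are \<open>s' (s x r) r'\<close>: multiplication in
  \<open>op_ring R\<close> turns the product of \<open>s\<close> and \<open>s'\<close> into
  \<open>s' s\<close>, which is the order in which the two left actions are applied.\<close>

lemma formal_smult_mult:
  assumes a: "a \<in> carrier E.env.P" and b: "b \<in> carrier E.env.P" and x: "x \<in> carrier M"
  shows "formal_smult M (a \<otimes>\<^bsub>E.env.P\<^esub> b) x = formal_smult M b (formal_smult M a x)"
  using a
proof (induction a rule: E.env.pair_induct)
  case zero
  show ?case
    using abelian_group_hom.hom_zero[OF formal_smult_hom[OF b]]
    by (simp add: formal_smult_zero mult_pair_simps)
next
  case (of r s)
  then have rs: "frag_of (r, s) \<in> carrier E.env.P" by (rule E.env.pair_frag_of_closed)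
  show ?case using b
  proof (induction b rule: E.env.pair_induct)
    case zero
    show ?case by (simp add: formal_smult_zero mult_pair_simps)
  next
    case (of r' s')
    then show ?case
      using \<open>r \<in> carrier R\<close> \<open>s \<in> carrier (op_ring R)\<close> x
      by (simp add: mult_pair_simps formal_smult_frag_of lsmult_assoc rsmult_assoc lrsmult_assoc
          lsmult_closed rsmult_closed)
  next
    case (minus b b')
    have "frag_of (r, s) \<otimes>\<^bsub>E.env.P\<^esub> b \<in> carrier E.env.P"
      "frag_of (r, s) \<otimes>\<^bsub>E.env.P\<^esub> b' \<in> carrier E.env.P"
      using rs minus(1,2) by simp_all
    with minus x formal_smult_closed[OF env_carrierD[OF rs] x] show ?case
      by (simp add: mult_pair_simps formal_smult_diff env_carrierD formal_smult_closed)
  qed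
next
  case (minus a a')
  have "a \<otimes>\<^bsub>E.env.P\<^esub> b \<in> carrier E.env.P" "a' \<otimes>\<^bsub>E.env.P\<^esub> b \<in> carrier E.env.P"
    using b minus(1,2) by simp_all
  with minus b x show ?case
    by (simp add: mult_pair_simps formal_smult_diff env_carrierD formal_smult_closed
        abelian_group_hom.hom_minus[OF formal_smult_hom[OF b]])
qed

text \<open>All representatives of a tensor act alike because the kernel acts as zero, so the set
  under \<open>the_elem\<close> is a singleton. Identities for the action can then be checked on the
  free group.\<close>

lemma env_module_coset:
  assumes c: "c \<in> carrier E.env.P" and x: "x \<in> carrier M"
  shows "(E.env.I +>\<^bsub>E.env.P\<^esub> c) \<odot>\<^bsub>env_module R M\<^esub> x = formal_smult M c x"
proof -
  have "formal_smult M b x = formal_smult M c x" if b: "b \<in> E.env.I +>\<^bsub>E.env.P\<^esub> c" for b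
  proof -
    obtain k where k: "k \<in> E.env.I" "b = k + c"
      using b by (auto simp: a_r_coset_def')
    show ?thesis
      using formal_smult_kernel[OF k(1) x] k(2) env_carrierD[OF c] x
      by (simp add: formal_smult_add formal_smult_closed)
  qed
  moreover have "c \<in> E.env.I +>\<^bsub>E.env.P\<^esub> c"
    by (rule E.env.I.a_rcos_self[OF c])
  ultimately have "(\<lambda>b. formal_smult M b x) ` (E.env.I +>\<^bsub>E.env.P\<^esub> c) = {formal_smult M c x}"
    by blast
  then show ?thesis by (simp add: env_module_def)
qed

lemma env_module_simps:
  "carrier (env_module R M) = carrier M" "x \<oplus>\<^bsub>env_module R M\<^esub> y = x \<oplus>\<^bsub>M\<^esub> y"
  "\<zero>\<^bsub>env_module R M\<^esub> = \<zero>\<^bsub>M\<^esub>" "H +>\<^bsub>env_module R M\<^esub> x = H +>\<^bsub>M\<^esub> x"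
  by (simp_all add: env_module_def a_r_coset_def')

lemma right_module_env: "right_module (env_ring R) (env_module R M)"
proof (intro right_module.intro right_module_axioms.intro E.env.T.ring_axioms)
  show "abelian_group (env_module R M)"
    by (rule abelian_groupI)
      (auto simp: env_module_simps M.a_ac intro: M.l_neg M.a_inv_closed)
next
  fix t x assume "t \<in> carrier (env_ring R)" and x: "x \<in> carrier (env_module R M)"
  then obtain a where a: "a \<in> carrier E.env.P" "t = E.env.I +>\<^bsub>E.env.P\<^esub> a"
    by (blast elim: E.env.tensor_coset)
  note x = x[unfolded env_module_simps]
  show "t \<odot>\<^bsub>env_module R M\<^esub> x \<in> carrier (env_module R M)"
    unfolding a(2) env_module_coset[OF a(1) x] env_module_simps
    by (rule formal_smult_closed[OF env_carrierD[OF a(1)] x])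
  {
    fix u assume "u \<in> carrier (env_ring R)"
    then obtain b where b: "b \<in> carrier E.env.P" "u = E.env.I +>\<^bsub>E.env.P\<^esub> b"
      by (blast elim: E.env.tensor_coset)
    have ab: "a \<oplus>\<^bsub>E.env.P\<^esub> b \<in> carrier E.env.P" "a \<otimes>\<^bsub>E.env.P\<^esub> b \<in> carrier E.env.P"
      using a(1) b(1) by (simp_all add: E.env.pair_add_closed)
    have ax: "formal_smult M a x \<in> carrier M"
      by (rule formal_smult_closed[OF env_carrierD[OF a(1)] x])
    show "(t \<oplus>\<^bsub>env_ring R\<^esub> u) \<odot>\<^bsub>env_module R M\<^esub> x =
      t \<odot>\<^bsub>env_module R M\<^esub> x \<oplus>\<^bsub>env_module R M\<^esub> u \<odot>\<^bsub>env_module R M\<^esub> x"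
      unfolding a(2) b(2) E.env.\<pi>.hom_add[OF a(1) b(1), symmetric] env_module_coset[OF a(1) x]
        env_module_coset[OF b(1) x] env_module_coset[OF ab(1) x] env_module_simps
      using a(1) b(1) x by (simp add: formal_smult_add env_carrierD)
    show "(t \<otimes>\<^bsub>env_ring R\<^esub> u) \<odot>\<^bsub>env_module R M\<^esub> x = u \<odot>\<^bsub>env_module R M\<^esub> (t \<odot>\<^bsub>env_module R M\<^esub> x)"
      unfolding a(2) b(2) E.env.\<pi>.hom_mult[OF a(1) b(1), symmetric] env_module_coset[OF a(1) x]
        env_module_coset[OF b(1) ax] env_module_coset[OF ab(2) x]
      by (rule formal_smult_mult[OF a(1) b(1) x])
  }
  fix y assume y: "y \<in> carrier (env_module R M)"
  note y = y[unfolded env_module_simps]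
  have xy: "x \<oplus>\<^bsub>M\<^esub> y \<in> carrier M" using x y by simp
  show "t \<odot>\<^bsub>env_module R M\<^esub> (x \<oplus>\<^bsub>env_module R M\<^esub> y) =
      t \<odot>\<^bsub>env_module R M\<^esub> x \<oplus>\<^bsub>env_module R M\<^esub> t \<odot>\<^bsub>env_module R M\<^esub> y"
    unfolding a(2) env_module_simps env_module_coset[OF a(1) x] env_module_coset[OF a(1) y]
      env_module_coset[OF a(1) xy]
    by (rule formal_smult_r_distr[OF a(1) x y])
qed

section \<open>From bimodule derivations to derivations of right modules\<close>

context
  fixes \<delta> d
  assumes \<delta>: "ring_derivation R \<delta>" and d: "bimodule_derivation R M \<delta> d"
begin

abbreviation D where "D \<equiv> E.env.tensor_derivation \<delta> \<delta>"

lemma d_simps: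
  "x \<in> carrier M \<Longrightarrow> d x \<in> carrier M"
  "\<lbrakk>x \<in> carrier M; y \<in> carrier M\<rbrakk> \<Longrightarrow> d (x \<oplus>\<^bsub>M\<^esub> y) = d x \<oplus>\<^bsub>M\<^esub> d y"
  "\<lbrakk>x \<in> carrier M; r \<in> carrier R\<rbrakk> \<Longrightarrow> d (rsmult M x r) = rsmult M (d x) r \<oplus>\<^bsub>M\<^esub> rsmult M x (\<delta> r)"
  "\<lbrakk>x \<in> carrier M; r \<in> carrier R\<rbrakk> \<Longrightarrow> d (lsmult M r x) = lsmult M (\<delta> r) x \<oplus>\<^bsub>M\<^esub> lsmult M r (d x)"
  using d by (auto simp: bimodule_derivation_def)

lemma derivation_closed: "r \<in> carrier R \<Longrightarrow> \<delta> r \<in> carrier R"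
  using \<delta> by (auto simp: ring_derivation_def)

text \<open>On a generator this is the three-term expansion of \<open>d (s x r)\<close>. The terms
  that differentiate \<open>r\<close> or \<open>s\<close> are the two summands of
  \<open>pair_derivation\<close>.\<close>

lemma derivation_formal_smult:
  assumes c: "c \<in> carrier E.env.P" and x: "x \<in> carrier M"
  shows "d (formal_smult M c x) =
    formal_smult M c (d x) \<oplus>\<^bsub>M\<^esub> formal_smult M (E.env.pair_derivation \<delta> \<delta> c) x"
proof -
  interpret d: abelian_group_hom M M d
    by (rule abelian_group_homI') (auto simp: d_simps M.abelian_group_axioms)
  note \<delta>op = E.ring_derivation_op_ring[OF \<delta>]
  from c show ?thesis
  proof (induction c rule: E.env.pair_induct)
    case zero
    show ?case by (simp add: formal_smult_zero E.env.pair_derivation_simps)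
  next
    case (of r s)
    then show ?case
      using x by (simp add: E.env.pair_derivation_simps formal_smult_frag_of formal_smult_add d_simps
          derivation_closed lsmult_closed rsmult_closed lsmult_r_distr M.a_ac)
  next
    case (minus a b)
    note c = E.env.pair_derivation_closed[OF \<delta> \<delta>op minus(1)]
      E.env.pair_derivation_closed[OF \<delta> \<delta>op minus(2)]
    show ?case
      using minus x c
      by (simp add: E.env.pair_derivation_simps formal_smult_diff d_simps env_carrierD
          formal_smult_closed d.hom_minus M.minus_add_minus)
  qed
qed

lemma env_derivation_module:
  assumes "symmetric_filter R F"
  shows "derivation_module (env_ring R) (env_module R M) F D d"
proof (intro derivation_module.intro filtered_module.intro right_module_env
    E.symmetric_filter_gabriel assms derivation_module_axioms.intro)
  note \<delta>op = E.ring_derivation_op_ring[OF \<delta>]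
  show "ring_derivation (env_ring R) D" by (rule E.env.ring_derivation_tensor[OF \<delta> \<delta>op])
  fix t x assume "t \<in> carrier (env_ring R)" and x: "x \<in> carrier (env_module R M)"
  then obtain a where a: "a \<in> carrier E.env.P" "t = E.env.I +>\<^bsub>E.env.P\<^esub> a"
    by (blast elim: E.env.tensor_coset)
  note x = x[unfolded env_module_simps]
  show "d (t \<odot>\<^bsub>env_module R M\<^esub> x) =
      t \<odot>\<^bsub>env_module R M\<^esub> d x \<oplus>\<^bsub>env_module R M\<^esub> D t \<odot>\<^bsub>env_module R M\<^esub> x"
    unfolding a(2) E.env.tensor_derivation_coset[OF \<delta> \<delta>op a(1)] env_module_coset[OF a(1) x]
      env_module_coset[OF a(1) d_simps(1)[OF x]]
      env_module_coset[OF E.env.pair_derivation_closed[OF \<delta> \<delta>op a(1)] x] env_module_simps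
    by (rule derivation_formal_smult[OF a(1) x])
qed (simp_all add: env_module_simps d_simps)

text \<open>Since \<open>\<delta>\<close> kills \<open>\<one>\<close>, one of the two summands in
  the value at a pure tensor vanishes. These values turn the Leibniz rule over the enveloping ring
  back into the two one-sided rules over \<open>R\<close>.\<close>

lemma env_derivation_left:
  "r \<in> carrier R \<Longrightarrow> D (env_tensor R r \<one>) = env_tensor R (\<delta> r) \<one>"
  and env_derivation_right:
  "s \<in> carrier R \<Longrightarrow> D (env_tensor R \<one> s) = env_tensor R \<one> (\<delta> s)"
proof -
  note \<delta>op = E.ring_derivation_op_ring[OF \<delta>]
  \<comment> \<open>Additivity at \<open>\<zero> \<oplus> \<zero>\<close> shows that each of these
    tensors equals its own double.\<close>
  have z: "env_tensor R r \<zero> = \<zero>\<^bsub>env_ring R\<^esub>" "env_tensor R \<zero> r = \<zero>\<^bsub>env_ring R\<^esub>"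
    if "r \<in> carrier R" for r
    using E.env.pure_tensor_add_right[of r \<zero> \<zero>] E.env.pure_tensor_add_left[of \<zero> \<zero> r] that
      E.env.T.add.r_cancel_one' E.env.pure_tensor_closed[of r \<zero>] E.env.pure_tensor_closed[of \<zero> r]
    by simp_all
  show "D (env_tensor R r \<one>) = env_tensor R (\<delta> r) \<one>" if "r \<in> carrier R"
    using that E.env.tensor_derivation_pure[OF \<delta> \<delta>op that, of \<one>] derivation_closed[OF that]
      E.env.pure_tensor_closed[of "\<delta> r" \<one>]
    by (simp add: R.ring_derivation_one[OF \<delta>] z)
  show "D (env_tensor R \<one> s) = env_tensor R \<one> (\<delta> s)" if "s \<in> carrier R"
    using that E.env.tensor_derivation_pure[OF \<delta> \<delta>op, of \<one> s] derivation_closed[OF that]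
      E.env.pure_tensor_closed[of \<one> "\<delta> s"]
    by (simp add: R.ring_derivation_one[OF \<delta>] z)
qed

text \<open>Exports the induced derivation through its values on cosets, so that the quotients for
  two filters can be handled side by side.\<close>

lemma torsion_quotient_derivation_module:
  assumes F: "symmetric_filter R F"
  obtains e where "derivation_module (env_ring R) (torsion_quotient R F M) F D e"
    and "\<And>x. x \<in> carrier M \<Longrightarrow>
      e (symmetric_torsion R F M +>\<^bsub>M\<^esub> x) = symmetric_torsion R F M +>\<^bsub>M\<^esub> d x"
    and "carrier (torsion_quotient R F M) = (\<lambda>x. symmetric_torsion R F M +>\<^bsub>M\<^esub> x) ` carrier M"
    and "\<And>x y. \<lbrakk>x \<in> carrier M; y \<in> carrier M\<rbrakk> \<Longrightarrow>
      (symmetric_torsion R F M +>\<^bsub>M\<^esub> x) \<oplus>\<^bsub>torsion_quotient R F M\<^esub> (symmetric_torsion R F M +>\<^bsub>M\<^esub> y)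
      = symmetric_torsion R F M +>\<^bsub>M\<^esub> (x \<oplus>\<^bsub>M\<^esub> y)"
    and "\<And>t x. \<lbrakk>t \<in> carrier (env_ring R); x \<in> carrier M\<rbrakk> \<Longrightarrow>
      t \<odot>\<^bsub>torsion_quotient R F M\<^esub> (symmetric_torsion R F M +>\<^bsub>M\<^esub> x)
      = symmetric_torsion R F M +>\<^bsub>M\<^esub> t \<odot>\<^bsub>env_module R M\<^esub> x"
proof -
  interpret N: derivation_module "env_ring R" "env_module R M" F D d
    by (rule env_derivation_module[OF F])
  show ?thesis
    using that[of N.quotient_derivation] N.derivation_module_quotient N.quotient_derivation_coset
      N.quotient_carrier N.quotient_add N.quotient_smult
    by (simp add: env_module_simps torsion_quotient_def symmetric_torsion_def)
qed

text \<open>The bimodule structure of \<open>symmetric_quotients\<close> is the action of the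
  elements \<open>r \<otimes> 1\<close> and \<open>1 \<otimes> s\<close>, so both Leibniz rules are
  instances of \<open>limit_derivation_smult\<close>. Compatibility with \<open>quotient_map\<close>
  is \<open>germ_smult_left\<close> at the coset of \<open>m\<close>.\<close>

lemma extends_to_limit:
  assumes e: "derivation_module (env_ring R) (torsion_quotient R F M) F D e"
    and coset: "\<And>x. x \<in> carrier M \<Longrightarrow>
      e (symmetric_torsion R F M +>\<^bsub>M\<^esub> x) = symmetric_torsion R F M +>\<^bsub>M\<^esub> d x"
    and car: "carrier (torsion_quotient R F M) = (\<lambda>x. symmetric_torsion R F M +>\<^bsub>M\<^esub> x) ` carrier M"
  shows "extends_to R F M \<delta> d
    (derivation_module.limit_derivation (env_ring R) (torsion_quotient R F M) F D e)"
proof -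
  interpret Q: derivation_module "env_ring R" "torsion_quotient R F M" F D e by fact
  have sq: "carrier (symmetric_quotients R F M) = carrier (symmetric_limit R F M)"
    "add (symmetric_quotients R F M) = add (symmetric_limit R F M)"
    "lsmult (symmetric_quotients R F M) s X = env_tensor R \<one> s \<odot>\<^bsub>symmetric_limit R F M\<^esub> X"
    "rsmult (symmetric_quotients R F M) X s = env_tensor R s \<one> \<odot>\<^bsub>symmetric_limit R F M\<^esub> X" for s X
    by (simp_all add: symmetric_quotients_def Let_def)
  have t: "env_tensor R \<one> s \<in> carrier (env_ring R)" "env_tensor R s \<one> \<in> carrier (env_ring R)"
    if "s \<in> carrier R" for s
    using E.env.pure_tensor_closed[of \<one> s] E.env.pure_tensor_closed[of s \<one>] that by simp_all
  have "bimodule_derivation R (symmetric_quotients R F M) \<delta> Q.limit_derivation"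
    unfolding bimodule_derivation_def sq unfolding symmetric_limit_def
  proof (intro conjI ballI funcsetI)
    fix X assume X: "X \<in> carrier (limit_module (env_ring R) F (torsion_quotient R F M))"
    show "Q.limit_derivation X \<in> carrier (limit_module (env_ring R) F (torsion_quotient R F M))"
      by (rule Q.limit_derivation_closed[OF X])
    fix r assume r: "r \<in> carrier R"
    show "Q.limit_derivation (env_tensor R r \<one> \<odot>\<^bsub>limit_module (env_ring R) F (torsion_quotient R F M)\<^esub> X) =
      env_tensor R r \<one> \<odot>\<^bsub>limit_module (env_ring R) F (torsion_quotient R F M)\<^esub> Q.limit_derivation X
      \<oplus>\<^bsub>limit_module (env_ring R) F (torsion_quotient R F M)\<^esub>
      env_tensor R (\<delta> r) \<one> \<odot>\<^bsub>limit_module (env_ring R) F (torsion_quotient R F M)\<^esub> X"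
      unfolding Q.limit_derivation_smult[OF t(2)[OF r] X] env_derivation_left[OF r] ..
    show "Q.limit_derivation (env_tensor R \<one> r \<odot>\<^bsub>limit_module (env_ring R) F (torsion_quotient R F M)\<^esub> X) =
      env_tensor R \<one> (\<delta> r) \<odot>\<^bsub>limit_module (env_ring R) F (torsion_quotient R F M)\<^esub> X
      \<oplus>\<^bsub>limit_module (env_ring R) F (torsion_quotient R F M)\<^esub>
      env_tensor R \<one> r \<odot>\<^bsub>limit_module (env_ring R) F (torsion_quotient R F M)\<^esub> Q.limit_derivation X"
      unfolding Q.limit_derivation_smult[OF t(1)[OF r] X] env_derivation_right[OF r]
      by (intro Q.limit_add_comm Q.limit_smult_closed t r derivation_closed X Q.limit_derivation_closed)
  qed (rule Q.limit_derivation_add)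
  moreover have "Q.limit_derivation (quotient_map R F M m) = quotient_map R F M (d m)"
    if m: "m \<in> carrier M" for m
    using Q.germ_smult_left(2)[of "symmetric_torsion R F M +>\<^bsub>M\<^esub> m"] m
    by (simp add: quotient_map_def Let_def car coset)
  ultimately show ?thesis by (simp add: extends_to_def)
qed

section \<open>Agreement of the extensions\<close>

theorem symmetric_extensions_agree:
  assumes F1: "symmetric_filter R F1" and F2: "symmetric_filter R F2" and F: "F1 \<subseteq> F2"
  shows "extensions_agree R F1 F2 M \<delta> d"
proof -
  obtain e1 where e1: "derivation_module (env_ring R) (torsion_quotient R F1 M) F1 D e1"
    and coset1: "\<And>x. x \<in> carrier M \<Longrightarrow>
      e1 (symmetric_torsion R F1 M +>\<^bsub>M\<^esub> x) = symmetric_torsion R F1 M +>\<^bsub>M\<^esub> d x"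
    and car1: "carrier (torsion_quotient R F1 M) = (\<lambda>x. symmetric_torsion R F1 M +>\<^bsub>M\<^esub> x) ` carrier M"
    and add1: "\<And>x y. \<lbrakk>x \<in> carrier M; y \<in> carrier M\<rbrakk> \<Longrightarrow>
      (symmetric_torsion R F1 M +>\<^bsub>M\<^esub> x) \<oplus>\<^bsub>torsion_quotient R F1 M\<^esub> (symmetric_torsion R F1 M +>\<^bsub>M\<^esub> y)
      = symmetric_torsion R F1 M +>\<^bsub>M\<^esub> (x \<oplus>\<^bsub>M\<^esub> y)"
    and smult1: "\<And>t x. \<lbrakk>t \<in> carrier (env_ring R); x \<in> carrier M\<rbrakk> \<Longrightarrow>
      t \<odot>\<^bsub>torsion_quotient R F1 M\<^esub> (symmetric_torsion R F1 M +>\<^bsub>M\<^esub> x)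
      = symmetric_torsion R F1 M +>\<^bsub>M\<^esub> t \<odot>\<^bsub>env_module R M\<^esub> x"
    using torsion_quotient_derivation_module[OF F1] by metis
  obtain e2 where e2: "derivation_module (env_ring R) (torsion_quotient R F2 M) F2 D e2"
    and coset2: "\<And>x. x \<in> carrier M \<Longrightarrow>
      e2 (symmetric_torsion R F2 M +>\<^bsub>M\<^esub> x) = symmetric_torsion R F2 M +>\<^bsub>M\<^esub> d x"
    and car2: "carrier (torsion_quotient R F2 M) = (\<lambda>x. symmetric_torsion R F2 M +>\<^bsub>M\<^esub> x) ` carrier M"
    and add2: "\<And>x y. \<lbrakk>x \<in> carrier M; y \<in> carrier M\<rbrakk> \<Longrightarrow>
      (symmetric_torsion R F2 M +>\<^bsub>M\<^esub> x) \<oplus>\<^bsub>torsion_quotient R F2 M\<^esub> (symmetric_torsion R F2 M +>\<^bsub>M\<^esub> y)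
      = symmetric_torsion R F2 M +>\<^bsub>M\<^esub> (x \<oplus>\<^bsub>M\<^esub> y)"
    and smult2: "\<And>t x. \<lbrakk>t \<in> carrier (env_ring R); x \<in> carrier M\<rbrakk> \<Longrightarrow>
      t \<odot>\<^bsub>torsion_quotient R F2 M\<^esub> (symmetric_torsion R F2 M +>\<^bsub>M\<^esub> x)
      = symmetric_torsion R F2 M +>\<^bsub>M\<^esub> t \<odot>\<^bsub>env_module R M\<^esub> x"
    using torsion_quotient_derivation_module[OF F2] by metis
  interpret N1: derivation_module "env_ring R" "env_module R M" F1 D d
    by (rule env_derivation_module[OF F1])
  interpret N2: derivation_module "env_ring R" "env_module R M" F2 D d
    by (rule env_derivation_module[OF F2])
  let ?p = "torsion_projection R F2 M"
  \<comment> \<open>A larger filter has a larger torsion submodule, so the identity of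
    \<open>M\<close> descends to the torsion quotients.\<close>
  have p: "?p (symmetric_torsion R F1 M +>\<^bsub>M\<^esub> x) = symmetric_torsion R F2 M +>\<^bsub>M\<^esub> x"
    if x: "x \<in> carrier M" for x
  proof -
    have "abelian_group_hom (env_module R M) (env_module R M) (\<lambda>x. x)"
      by (rule abelian_group_homI') (auto simp: N1.N.abelian_group_axioms)
    moreover have "torsion (env_ring R) F1 (env_module R M) \<subseteq> torsion (env_ring R) F2 (env_module R M)"
      using F by (auto simp: torsion_def)
    ultimately show ?thesis
      using coset_map_apply[of "env_module R M" "env_module R M" "\<lambda>x. x"]
        N1.torsion_additive_subgroup N2.torsion_additive_subgroup x
      by (simp add: env_module_simps torsion_projection_def symmetric_torsion_def)
  qed
  have "derivation_module.limit_derivation (env_ring R) (torsion_quotient R F2 M) F2 D e2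
        (quotient_comparison R F2 M X) =
      quotient_comparison R F2 M
        (derivation_module.limit_derivation (env_ring R) (torsion_quotient R F1 M) F1 D e1 X)"
    if X: "X \<in> carrier (symmetric_quotients R F1 M)" for X
    unfolding quotient_comparison_def
  \<comment> \<open>The projection intertwines \<open>e1\<close> and \<open>e2\<close>: both ways
    round, the coset of \<open>x\<close> goes to the coset of \<open>d x\<close> modulo the
    \<open>F2\<close>-torsion.\<close>
  proof (rule limit_map_derivation[OF e1 e2 F])
    show "X \<in> carrier (limit_module (env_ring R) F1 (torsion_quotient R F1 M))"
      using X by (simp add: symmetric_quotients_def symmetric_limit_def Let_def)
  qed (auto simp: right_module_map_def car1 car2 p add1 add2 smult1 smult2 coset1 coset2 d_simps
      N1.smult_closed[unfolded env_module_simps])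
  then show ?thesis
    unfolding extensions_agree_def
    using extends_to_limit[OF e1 coset1 car1] extends_to_limit[OF e2 coset2 car2] by blast
qed

end

end

text \<open>Makes the assertion about \<open>R\<close> the instance of the bimodule case in which
  \<open>d\<close> is \<open>\<delta>\<close> itself.\<close>

lemma bimodule_derivation_regular:
  "ring_derivation R \<delta> \<Longrightarrow> bimodule_derivation R (regular_bimodule R) \<delta> \<delta>"
  by (simp add: ring_derivation_def bimodule_derivation_def regular_bimodule_def)

theorem proposition4:
  fixes R :: "('a, 'x) ring_scheme"
    and M :: "('a, 'm, 'y) bimodule_scheme"
    and F1 F2 :: "'a env set set"
  assumes "ring R"
    and "bimodule R M"
    and "symmetric_filter R F1"
    and "symmetric_filter R F2"
    and "F1 \<subseteq> F2"
    and "differential_filter R F1"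
  shows "(torsion_free R F2 (symmetric_quotients R F1 M) \<or> differential_filter R F2 \<longrightarrow>
           (\<forall>\<delta> d. ring_derivation R \<delta> \<and> bimodule_derivation R M \<delta> d \<longrightarrow>
              extensions_agree R F1 F2 M \<delta> d)) \<and>
         (torsion_free R F2 (symmetric_quotients R F1 (regular_bimodule R)) \<or>
            differential_filter R F2 \<or>
            (faithful_filter R F1 \<and> faithful_filter R F2) \<longrightarrow>
           (\<forall>\<delta>. ring_derivation R \<delta> \<longrightarrow>
              extensions_agree R F1 F2 (regular_bimodule R) \<delta> \<delta>))"
  using bimodule.symmetric_extensions_agree[OF assms(2) _ _ assms(3-5)]
    bimodule.symmetric_extensions_agree[OF bimodule_regular[OF assms(1)] _ _ assms(3-5)]
    bimodule_derivation_regular[of R]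
  by blast

end
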